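(* Let $\mathbb{F}$ be a field. Let $K_1(\lambda)$ and $N_1(\lambda)$ be a pair of dual minimal bases over $\mathbb{F}$, and let $K_2(\lambda)$ and $N_2(\lambda)$ be another pair of dual minimal bases over $\mathbb{F}$. Let $$\mathcal{L}(\lambda)=\begin{bmatrix} M(\lambda) & K_2(\lambda)^T\\ K_1(\lambda) & 0\end{bmatrix}$$ be a matrix pencil (so $\mathcal{L}(\lambda)$ is a block minimal bases pencil), and consider the matrix polynomial $$Q(\lambda):=N_2(\lambda)\,M(\lambda)\,N_1(\lambda)^T .$$ Then: (a) $\mathcal{L}(\lambda)$ is a linearization of $Q(\lambda)$. (b) If $\mathcal{L}(\lambda)$ is a strong block minimal bases pencil, then $\mathcal{L}(\lambda)$ is a strong linearization of $Q(\lambda)$, where $Q(\lambda)$ is considered as a polynomial with grade $1+\deg(N_1(\lambda))+\deg(N_2(\lambda))$.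
   Context: Matrix polynomials have entries in $\mathbb{F}[\lambda]$. A matrix polynomial $P(\lambda)$ has grade $d$ if it is written $P(\lambda)=\sum_{i=0}^d P_i\lambda^i$ with constant matrices $P_i$ (possibly $P_d=0$); $\deg(P)$ is the largest $k$ with $P_k\neq 0$. A matrix pencil is a matrix polynomial of grade $1$. For $d\ge\deg(P)$, $\mathrm{rev}_d P(\lambda):=\lambda^dP(\lambda^{-1})$. A square matrix polynomial is unimodular if its determinant is a nonzero constant. Minimal bases: the rational subspace spanned by the rows of a matrix polynomial $Q$ is their span over $\mathbb{F}(\lambda)$. A matrix polynomial (with fewer rows than columns) is called a minimal basis if its rows form a polynomial basis of the rational subspace they span with least possible sum of row degrees among all polynomial bases of that subspace (the degree of a row is the maximum degree of its entries). Equivalently, $Q(\lambda_0)$ has full row rank for all $\lambda_0$ in the algebraic closure $\overline{\mathbb{F}}$ and the constant matrix whose $j$th row is the coefficient of $\lambda^{d_j}$ in the $j$th row of $Q$ ($d_j$ the degree of that row) has full row rank. Two matrix polynomials $L(\lambda)\in\mathbb{F}[\lambda]^{m_1\times n}$, $N(\lambda)\in\mathbb{F}[\lambda]^{m_2\times n}$ are dual minimal bases if both are minimal bases, $m_1+m_2=n$, and $L(\lambda)N(\lambda)^T=0$. A pencil $\mathcal{L}(\lambda)=\begin{bmatrix} M(\lambda) & K_2(\lambda)^T\\ K_1(\lambda) & 0\end{bmatrix}$ is a block minimal bases pencil if $K_1(\lambda)$ and $K_2(\lambda)$ are both minimal bases. It is a strong block minimal bases pencil if, in addition, all row degrees of $K_1(\lambda)$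 equal $1$, all row degrees of $K_2(\lambda)$ equal $1$, all row degrees of a minimal basis dual to $K_1(\lambda)$ are equal to each other, and all row degrees of a minimal basis dual to $K_2(\lambda)$ are equal to each other. The cases where $K_1$ or $K_2$ is empty are allowed: if $K_1$ (resp. $K_2$) is empty, then $N_1=I_s$ (resp. $N_2=I_s$), where $s$ is the number of columns (resp. rows) of $M(\lambda)$. A pencil $\mathcal{L}(\lambda)$ is a linearization of a matrix polynomial $P(\lambda)$ of grade $d$ if for some $s\ge 0$ there are unimodular matrix polynomials $U(\lambda),V(\lambda)$ with $U(\lambda)\mathcal{L}(\lambda)V(\lambda)=\mathrm{diag}(I_s,P(\lambda))$; it is a strong linearization if moreover $\mathrm{rev}_1\mathcal{L}(\lambda)$ is a linearization of $\mathrm{rev}_dP(\lambda)$. *)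

theory Defs
  imports
    "Jordan_Normal_Form.VS_Connect"
    "Jordan_Normal_Form.Determinant"
    "HOL-Computational_Algebra.Polynomial_Factorial"
begin

text \<open>
  Matrix polynomials over a field are matrices of type \<^typ>\<open>'a::field poly mat\<close>; matrices with
  zero rows or zero columns are included.
\<close>

subsection \<open>Degree, grade, reversal\<close>

definition coeff_matrix :: "'a::field poly mat \<Rightarrow> nat \<Rightarrow> 'a mat" where
  "coeff_matrix P k = map_mat (\<lambda>p. coeff p k) P"

text \<open>The degree of a zero (or empty) matrix polynomial is \<open>0\<close> by convention.\<close>

definition mpoly_degree :: "'a::field poly mat \<Rightarrow> nat" where
  "mpoly_degree P = Max (insert 0 {k. coeff_matrix P k \<noteq> 0\<^sub>m (dim_row P) (dim_col P)})"

definition has_grade :: "nat \<Rightarrow> 'a::field poly mat \<Rightarrow> bool" where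
  "has_grade d P \<longleftrightarrow> mpoly_degree P \<le> d"

abbreviation is_pencil :: "'a::field poly mat \<Rightarrow> bool" where
  "is_pencil \<equiv> has_grade 1"

text \<open>
  \<open>rev_poly d p\<close> is \<open>\<lambda>\<^sup>d p(\<lambda>\<^sup>-\<^sup>1)\<close>, meaningful for \<open>degree p \<le> d\<close> only (higher coefficients
  are dropped).
\<close>

definition rev_poly :: "nat \<Rightarrow> 'a::field poly \<Rightarrow> 'a poly" where
  "rev_poly d p = (\<Sum>i\<le>d. monom (coeff p i) (d - i))"

definition mpoly_rev :: "nat \<Rightarrow> 'a::field poly mat \<Rightarrow> 'a poly mat" where
  "mpoly_rev d P = map_mat (rev_poly d) P"


subsection \<open>Minimal bases\<close>

definition row_degree :: "'a::field poly mat \<Rightarrow> nat \<Rightarrow> nat" where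
  "row_degree Q i = Max ((\<lambda>j. degree (Q $$ (i, j))) ` {..<dim_col Q})"

definition row_degree_sum :: "'a::field poly mat \<Rightarrow> nat" where
  "row_degree_sum Q = (\<Sum>i<dim_row Q. row_degree Q i)"

text \<open>The field of rational functions is \<^typ>\<open>'a::field poly fract\<close>.\<close>

abbreviation rational_mat :: "'a::field poly mat \<Rightarrow> 'a poly fract mat" where
  "rational_mat Q \<equiv> map_mat to_fract Q"

definition rational_row_space :: "'a::field poly mat \<Rightarrow> 'a poly fract vec set" where
  "rational_row_space Q = vec_space.row_space (dim_col Q) (rational_mat Q)"

text \<open>Distinctness is needed because linear independence is a property of the set of rows.\<close>

definition is_polynomial_basis :: "'a::field poly mat \<Rightarrow> 'a poly fract vec set \<Rightarrow> bool" where
  "is_polynomial_basis Q W \<longleftrightarrow>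
     distinct (rows (rational_mat Q)) \<and>
     \<not> module.lin_dep class_ring (module_vec TYPE('a poly fract) (dim_col Q))
         (set (rows (rational_mat Q))) \<and>
     rational_row_space Q = W"

definition minimal_basis :: "'a::field poly mat \<Rightarrow> bool" where
  "minimal_basis Q \<longleftrightarrow>
     dim_row Q < dim_col Q \<and>
     is_polynomial_basis Q (rational_row_space Q) \<and>
     (\<forall>R. dim_col R = dim_col Q \<and> is_polynomial_basis R (rational_row_space Q) \<longrightarrow>
          row_degree_sum Q \<le> row_degree_sum R)"

definition dual_minimal_bases :: "'a::field poly mat \<Rightarrow> 'a poly mat \<Rightarrow> bool" where
  "dual_minimal_bases K N \<longleftrightarrow>
     minimal_basis K \<and> minimal_basis N \<and>
     dim_col K = dim_col N \<and> dim_row K + dim_row N = dim_col K \<and>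
     K * transpose_mat N = 0\<^sub>m (dim_row K) (dim_row N)"

text \<open>
  In a block minimal bases pencil a block \<open>K\<close> may be empty, i.e. of size \<open>0 \<times> s\<close>; the identity
  matrix of size \<open>s\<close> then takes the place of its dual minimal basis.
\<close>

definition minimal_basis_or_empty :: "'a::field poly mat \<Rightarrow> bool" where
  "minimal_basis_or_empty K \<longleftrightarrow> minimal_basis K \<or> dim_row K = 0"

definition dual_minimal_bases_or_empty :: "'a::field poly mat \<Rightarrow> 'a poly mat \<Rightarrow> bool" where
  "dual_minimal_bases_or_empty K N \<longleftrightarrow>
     dual_minimal_bases K N \<or> (dim_row K = 0 \<and> N = 1\<^sub>m (dim_col K))"


subsection \<open>Block minimal bases pencils\<close>

definition block_pencil :: "'a::field poly mat \<Rightarrow> 'a poly mat \<Rightarrow> 'a poly mat \<Rightarrow> 'a poly mat" where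
  "block_pencil M K1 K2 =
     four_block_mat M (transpose_mat K2) K1 (0\<^sub>m (dim_row K1) (dim_row K2))"

definition block_minimal_bases_pencil ::
    "'a::field poly mat \<Rightarrow> 'a poly mat \<Rightarrow> 'a poly mat \<Rightarrow> bool" where
  "block_minimal_bases_pencil M K1 K2 \<longleftrightarrow>
     M \<in> carrier_mat (dim_col K2) (dim_col K1) \<and>
     is_pencil (block_pencil M K1 K2) \<and>
     minimal_basis_or_empty K1 \<and> minimal_basis_or_empty K2"

text \<open>
  All minimal bases dual to \<open>K\<close> have the same row degrees up to order, so ``a minimal basis dual
  to \<open>K\<close>'' is rendered existentially.
\<close>

definition strong_block_minimal_bases_pencil ::
    "'a::field poly mat \<Rightarrow> 'a poly mat \<Rightarrow> 'a poly mat \<Rightarrow> bool" where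
  "strong_block_minimal_bases_pencil M K1 K2 \<longleftrightarrow>
     block_minimal_bases_pencil M K1 K2 \<and>
     (\<forall>i<dim_row K1. row_degree K1 i = 1) \<and>
     (\<forall>i<dim_row K2. row_degree K2 i = 1) \<and>
     (\<exists>N. dual_minimal_bases_or_empty K1 N \<and>
          (\<forall>i<dim_row N. \<forall>j<dim_row N. row_degree N i = row_degree N j)) \<and>
     (\<exists>N. dual_minimal_bases_or_empty K2 N \<and>
          (\<forall>i<dim_row N. \<forall>j<dim_row N. row_degree N i = row_degree N j))"


subsection \<open>Linearizations\<close>

definition unimodular :: "'a::field poly mat \<Rightarrow> bool" where
  "unimodular U \<longleftrightarrow> square_mat U \<and> (\<exists>c. c \<noteq> 0 \<and> det U = [:c:])"

definition linearization :: "'a::field poly mat \<Rightarrow> 'a poly mat \<Rightarrow> bool" where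
  "linearization L P \<longleftrightarrow>
     is_pencil L \<and>
     (\<exists>s U V. unimodular U \<and> unimodular V \<and> dim_row U = dim_row L \<and> dim_row V = dim_col L \<and>
        U * L * V = four_block_mat (1\<^sub>m s) (0\<^sub>m s (dim_col P)) (0\<^sub>m (dim_row P) s) P)"

definition strong_linearization :: "nat \<Rightarrow> 'a::field poly mat \<Rightarrow> 'a poly mat \<Rightarrow> bool" where
  "strong_linearization d L P \<longleftrightarrow>
     has_grade d P \<and> linearization L P \<and> linearization (mpoly_rev 1 L) (mpoly_rev d P)"

end

theory Submission
  imports Defs "Jordan_Normal_Form.DL_Rank"
begin

text \<open>
  Minimality of \<open>K\<close> is used through an exchange argument: if a combination \<open>w K\<close> equals \<open>q v\<close> with
  \<open>w\<^sub>i \<noteq> 0\<close> and \<open>q \<noteq> 0\<close>, then \<open>v\<close> cannot have smaller degree than row \<open>i\<close>. Reducing \<open>w\<close> modulo \<open>p\<close>,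
  it follows that \<open>p dvd w K\<close> forces \<open>p dvd w\<close> for every nonconstant \<open>p\<close>, so that \<open>K\<close> has a polynomial
  right inverse; when all row degrees agree, the same holds for the reversal of \<open>K\<close>. This replaces
  the pointwise full rank criterion over the algebraic closure.

  Hence dual minimal bases \<open>K\<close>, \<open>N\<close> complete each other to mutually inverse unimodular matrices
  with row blocks \<open>K\<close>, \<open>D\<close> and column blocks \<open>B\<close>, \<open>N\<^sup>T\<close>, and every matrix with row blocks \<open>A\<close>, \<open>K\<close> is
  unimodularly equivalent to \<open>diag(I, A N\<^sup>T)\<close>. Applying this once to the rows and once to the columns of
  the pencil gives \<open>diag(I, N\<^sub>2 M N\<^sub>1\<^sup>T)\<close>. In the strong case the reversed pencil is built in the same
  way from the reversed bases.
\<close>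

subsection \<open>Polynomial bases\<close>

text \<open>Turns the set-based conditions of \<open>is_polynomial_basis\<close> into injectivity of
  the transpose, which matrix algebra can handle. Equal rows \<open>i\<close> and \<open>j\<close>
  count as dependent because the difference of their unit vectors is a kernel vector.\<close>

lemma independent_rows_iff:
  fixes A :: "'b::field mat"
  assumes A: "A \<in> carrier_mat m n"
  shows "distinct (rows A) \<and> \<not> module.lin_dep class_ring (module_vec TYPE('b) n) (set (rows A)) \<longleftrightarrow>
    (\<forall>y\<in>carrier_vec m. A\<^sup>T *\<^sub>v y = 0\<^sub>v n \<longrightarrow> y = 0\<^sub>v m)" (is "?L \<longleftrightarrow> ?R")
proof -
  interpret vec_space "TYPE('b)" n .
  have At: "A\<^sup>T \<in> carrier_mat n m" using A by simp
  show ?thesis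
  proof
    assume ?L
    then show ?R using lin_depI[OF At] by auto
  next
    assume R: ?R
    have "distinct (rows A)"
    proof (rule ccontr)
      assume "\<not> distinct (rows A)"
      then obtain i j where ij: "i < m" "j < m" "i \<noteq> j" "row A i = row A j"
        using A unfolding distinct_conv_nth by auto
      let ?y = "unit_vec m i - unit_vec m j :: 'b vec"
      have "A\<^sup>T *\<^sub>v ?y = 0\<^sub>v n"
      proof (intro eq_vecI)
        fix k assume "k < dim_vec (0\<^sub>v n :: 'b vec)"
        then have k: "k < n" by simp
        have "A $$ (i, k) = A $$ (j, k)"
          using ij(4) A k ij(1,2) by (metis carrier_matD index_row(1))
        moreover have "(A\<^sup>T *\<^sub>v ?y) $ k = col A k \<bullet> unit_vec m i - col A k \<bullet> unit_vec m j"
          using A k by (simp add: scalar_prod_minus_distrib[of _ m])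
        ultimately show "(A\<^sup>T *\<^sub>v ?y) $ k = 0\<^sub>v n $ k"
          using A k ij(1,2) by (simp add: scalar_prod_right_unit[of _ m])
      qed (use A in simp)
      then have "?y = 0\<^sub>v m" using R by simp
      then have "?y $ i = 0" using ij by simp
      then show False using ij by simp
    qed
    moreover have "\<not> lin_dep (set (rows A))"
    proof
      assume "lin_dep (set (rows A))"
      then obtain y where "y \<in> carrier_vec m" "y \<noteq> 0\<^sub>v m" "A\<^sup>T *\<^sub>v y = 0\<^sub>v n"
        using lin_depE[OF At] \<open>distinct (rows A)\<close> by (metis cols_transpose)
      then show False using R by blast
    qed
    ultimately show ?L by simp
  qed
qed

text \<open>Multiplication by an invertible \<open>T\<close> keeps the row space, and a kernel
  vector \<open>y\<close> for the transpose of \<open>R\<close> yields the kernel vector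
  \<open>T\<^sup>T *\<^sub>v y\<close> for that of \<open>Q\<close>.\<close>

lemma is_polynomial_basis_transform:
  fixes Q R :: "'a::field poly mat"
  assumes Q: "Q \<in> carrier_mat m n" and R: "R \<in> carrier_mat m n"
    and T: "T \<in> carrier_mat m m" "T' \<in> carrier_mat m m" "T * T' = 1\<^sub>m m"
    and eq: "rational_mat R = T * rational_mat Q"
    and basis: "is_polynomial_basis Q W"
  shows "is_polynomial_basis R W"
proof -
  interpret vec_space "TYPE('a poly fract)" n .
  have T'T: "T' * T = 1\<^sub>m m" using mat_mult_left_right_inverse[OF T] .
  then have inv: "invertible_mat T"
    using T unfolding invertible_mat_def inverts_mat_def by (auto simp: square_mat.simps)
  have Qc: "rational_mat Q \<in> carrier_mat m n" and Rc: "rational_mat R \<in> carrier_mat m n"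
    using Q R by auto
  have Qi: "\<forall>y\<in>carrier_vec m. (rational_mat Q)\<^sup>T *\<^sub>v y = 0\<^sub>v n \<longrightarrow> y = 0\<^sub>v m"
    using basis Q unfolding is_polynomial_basis_def independent_rows_iff[OF Qc, symmetric] by auto
  have "y = 0\<^sub>v m" if y: "y \<in> carrier_vec m" and 0: "(rational_mat R)\<^sup>T *\<^sub>v y = 0\<^sub>v n" for y
  proof -
    have "(rational_mat R)\<^sup>T *\<^sub>v y = (rational_mat Q)\<^sup>T *\<^sub>v (T\<^sup>T *\<^sub>v y)"
      unfolding eq transpose_mult[OF T(1) Qc]
      by (rule assoc_mult_mat_vec) (use Qc T y in auto)
    then have Ty: "T\<^sup>T *\<^sub>v y = 0\<^sub>v m" using Qi 0 T(1) y by auto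
    have "y = (T * T')\<^sup>T *\<^sub>v y" using T(3) y by simp
    also have "\<dots> = T'\<^sup>T *\<^sub>v (T\<^sup>T *\<^sub>v y)"
      unfolding transpose_mult[OF T(1,2)] by (rule assoc_mult_mat_vec) (use T y in auto)
    also have "\<dots> = 0\<^sub>v m" unfolding Ty using T by auto
    finally show ?thesis .
  qed
  moreover have "rational_row_space R = rational_row_space Q"
    unfolding rational_row_space_def using row_space_is_preserved[OF inv T(1) Qc] Q R eq by auto
  ultimately show ?thesis
    using basis R independent_rows_iff[OF Rc] unfolding is_polynomial_basis_def by auto
qed

text \<open>Independence over the fraction field is applied to the image of \<open>w\<close> under
  the injective map \<open>to_fract\<close>.\<close>

lemma is_polynomial_basis_independent:
  fixes Q :: "'a::field poly mat"
  assumes basis: "is_polynomial_basis Q W" and i: "i < dim_row Q"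
    and eq: "\<And>j. j < dim_col Q \<Longrightarrow> (\<Sum>k<dim_row Q. w k * Q $$ (k, j)) = 0"
  shows "w i = 0"
proof -
  let ?y = "vec (dim_row Q) (\<lambda>k. to_fract (w k))"
  have Qc: "rational_mat Q \<in> carrier_mat (dim_row Q) (dim_col Q)" by simp
  have "(rational_mat Q)\<^sup>T *\<^sub>v ?y = 0\<^sub>v (dim_col Q)"
  proof (rule eq_vecI)
    fix j assume "j < dim_vec (0\<^sub>v (dim_col Q) :: 'a poly fract vec)"
    then have j: "j < dim_col Q" by simp
    then have "((rational_mat Q)\<^sup>T *\<^sub>v ?y) $ j = to_fract (\<Sum>k<dim_row Q. w k * Q $$ (k, j))"
      by (simp add: scalar_prod_def atLeast0LessThan mult.commute)
    then show "((rational_mat Q)\<^sup>T *\<^sub>v ?y) $ j = 0\<^sub>v (dim_col Q) $ j"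
      unfolding eq[OF j] using j by simp
  qed simp
  then have "?y = 0\<^sub>v (dim_row Q)"
    using basis independent_rows_iff[OF Qc] unfolding is_polynomial_basis_def by auto
  then have "?y $ i = 0" using i by simp
  then show ?thesis using i by simp
qed

lemma row_degree_less_iff:
  assumes "0 < dim_col Q"
  shows "row_degree Q i < d \<longleftrightarrow> (\<forall>j<dim_col Q. degree (Q $$ (i, j)) < d)"
  using assms unfolding row_degree_def by (subst Max_less_iff) auto

lemma degree_le_row_degree:
  assumes "j < dim_col Q"
  shows "degree (Q $$ (i, j)) \<le> row_degree Q i"
  using assms unfolding row_degree_def by (intro Max_ge) auto

text \<open>Otherwise replacing row \<open>i\<close> by \<open>v\<close> would lower the row degree sum.\<close>

lemma minimal_basis_exchange:
  fixes Q :: "'a::field poly mat"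
  assumes min: "minimal_basis Q"
    and q: "q \<noteq> 0" and i: "i < dim_row Q" and wi: "w i \<noteq> 0"
    and eq: "\<And>j. j < dim_col Q \<Longrightarrow> (\<Sum>k<dim_row Q. w k * Q $$ (k, j)) = q * v j"
  shows "\<exists>j<dim_col Q. v j \<noteq> 0 \<and> row_degree Q i \<le> degree (v j)"
proof (rule ccontr)
  assume neg: "\<not> ?thesis"
  have "is_polynomial_basis Q (rational_row_space Q)" using min unfolding minimal_basis_def by blast
  \<comment> \<open>If all \<open>v j\<close> vanished, \<open>w\<close> would be a nontrivial
    relation between the rows of \<open>Q\<close>.\<close>
  then have "\<exists>j<dim_col Q. v j \<noteq> 0"
    using is_polynomial_basis_independent[OF _ i, of _ w] eq wi by force
  then have "0 < row_degree Q i" using neg by (metis not_gr_zero zero_le)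
  \<comment> \<open>As the row degree is positive, the strict bound also covers the zero entries of
    \<open>v\<close>, whose degree is 0 by convention.\<close>
  then have small: "\<And>j. j < dim_col Q \<Longrightarrow> degree (v j) < row_degree Q i"
    using neg by (metis degree_0 not_le)
  define m n where "m = dim_row Q" and "n = dim_col Q"
  have Q: "Q \<in> carrier_mat m n" by (simp add: m_def n_def)
  define R where "R = mat m n (\<lambda>(k, j). if k = i then v j else Q $$ (k, j))"
  \<comment> \<open>\<open>T\<close> is the identity with row \<open>i\<close> replaced by
    \<open>w / q\<close>, so multiplying \<open>Q\<close> by it replaces row \<open>i\<close> by
    \<open>v\<close>. \<open>T'\<close> is the explicit inverse; it exists because
    \<open>t i\<close> is nonzero.\<close>
  define t where "t k = to_fract (w k) / to_fract q" for k
  define T where "T = mat m m (\<lambda>(a, b). if a = i then t b else if a = b then 1 else 0)"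
  define T' where
    "T' = mat m m (\<lambda>(a, b). if a = i then (if b = i then 1 / t i else - t b / t i)
                             else if a = b then 1 else 0)"
  have R: "R \<in> carrier_mat m n" and T: "T \<in> carrier_mat m m" and T': "T' \<in> carrier_mat m m"
    by (simp_all add: R_def T_def T'_def)
  have im: "i < m" using i by (simp add: m_def)
  have ti: "t i \<noteq> 0" using wi q by (simp add: t_def)
  have TT': "T * T' = 1\<^sub>m m"
  proof (rule eq_matI)
    fix a b assume "a < dim_row (1\<^sub>m m :: 'a poly fract mat)" "b < dim_col (1\<^sub>m m :: 'a poly fract mat)"
    then have ab: "a < m" "b < m" by auto
    have "(T * T') $$ (a, b) = (\<Sum>k<m. T $$ (a, k) * T' $$ (k, b))"
      using ab T T' by (simp add: scalar_prod_def atLeast0LessThan)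
    also have "\<dots> = (1\<^sub>m m) $$ (a, b)"
    proof (cases "a = i")
      case False
      then have "(\<Sum>k<m. T $$ (a, k) * T' $$ (k, b)) = (\<Sum>k<m. if k = a then T' $$ (a, b) else 0)"
        using ab by (intro sum.cong) (auto simp: T_def)
      then show ?thesis using False ab by (simp add: T'_def)
    next
      case True
      have "(\<Sum>k<m. T $$ (a, k) * T' $$ (k, b)) =
        t i * T' $$ (i, b) + (\<Sum>k\<in>{..<m} - {i}. t k * T' $$ (k, b))"
        using ab True im by (subst sum.remove[of _ i]) (auto simp: T_def)
      also have "(\<Sum>k\<in>{..<m} - {i}. t k * T' $$ (k, b)) = (\<Sum>k\<in>{..<m} - {i}. if k = b then t b else 0)"
        using ab im by (intro sum.cong) (auto simp: T'_def)
      also have "\<dots> = (if b = i then 0 else t b)" using ab by (simp add: sum.delta)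
      finally show ?thesis using ab True im ti by (auto simp: T'_def)
    qed
    finally show "(T * T') $$ (a, b) = (1\<^sub>m m) $$ (a, b)" .
  qed (use T T' in auto)
  have RTQ: "rational_mat R = T * rational_mat Q"
  proof (rule eq_matI)
    fix a j assume "a < dim_row (T * rational_mat Q)" "j < dim_col (T * rational_mat Q)"
    then have aj: "a < m" "j < n" using T Q by auto
    have prod: "(T * rational_mat Q) $$ (a, j) = (\<Sum>k<m. T $$ (a, k) * to_fract (Q $$ (k, j)))"
      using aj T Q by (simp add: scalar_prod_def atLeast0LessThan)
    show "rational_mat R $$ (a, j) = (T * rational_mat Q) $$ (a, j)"
    proof (cases "a = i")
      case False
      then have "(\<Sum>k<m. T $$ (a, k) * to_fract (Q $$ (k, j))) =
        (\<Sum>k<m. if k = a then to_fract (Q $$ (a, j)) else 0)"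
        using aj by (intro sum.cong) (auto simp: T_def)
      then show ?thesis unfolding prod using False aj R by (simp add: R_def)
    next
      case True
      have "(\<Sum>k<m. T $$ (a, k) * to_fract (Q $$ (k, j))) =
        to_fract (\<Sum>k<m. w k * Q $$ (k, j)) / to_fract q"
        using aj True by (simp add: T_def t_def sum_divide_distrib)
      also have "\<dots> = to_fract (v j)"
        using eq[of j] aj q by (simp add: m_def n_def)
      finally show ?thesis unfolding prod using True aj by (simp add: R_def)
    qed
  qed (use R T Q in auto)
  have "is_polynomial_basis R (rational_row_space Q)"
    using is_polynomial_basis_transform[OF Q R T T' TT' RTQ] min unfolding minimal_basis_def by blast
  then have le: "row_degree_sum Q \<le> row_degree_sum R"
    using min R unfolding minimal_basis_def by (auto simp: n_def)
  have n0: "0 < n" using min unfolding minimal_basis_def n_def by simp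
  have less: "row_degree R i < row_degree Q i"
    using small R im n0 by (subst row_degree_less_iff) (auto simp: R_def n_def)
  have same: "row_degree R k = row_degree Q k" if "k < m" "k \<noteq> i" for k
    using that unfolding row_degree_def
    by (intro arg_cong[where f = Max] image_cong) (auto simp: R_def n_def)
  have "sum (row_degree R) {..<m} < sum (row_degree Q) {..<m}"
    using im less same by (intro sum_strict_mono_ex1) (auto simp: order.order_iff_strict)
  then have "row_degree_sum R < row_degree_sum Q"
    unfolding row_degree_sum_def using R Q by simp
  then show False using le by simp
qed

subsection \<open>Right invertibility\<close>

text \<open>
  Elements of \<open>C\<close> represent column vectors of length \<open>m\<close>; the entries beyond \<open>m\<close> are irrelevant.
  Induction on \<open>m\<close>: the last coordinates of \<open>C\<close> form an ideal, whose generator is a unit by the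
  hypothesis applied to multiples of the last unit vector.
\<close>

lemma saturated_submodule_full:
  fixes C :: "(nat \<Rightarrow> 'a::field poly) set"
  assumes closed: "\<And>f g a. f \<in> C \<Longrightarrow> g \<in> C \<Longrightarrow> (\<lambda>i. f i - a * g i) \<in> C"
    and ne: "C \<noteq> {}"
    and sat: "\<And>p w. 0 < degree p \<Longrightarrow> (\<And>c. c \<in> C \<Longrightarrow> p dvd (\<Sum>i<m. w i * c i)) \<Longrightarrow> \<forall>i<m. p dvd w i"
  shows "\<exists>c\<in>C. \<forall>i<m. c i = v i"
  using assms
proof (induction m arbitrary: C v)
  case 0
  then show ?case by auto
next
  case (Suc m)
  note closed = Suc.prems(1) and sat = Suc.prems(3)
  have zero: "(\<lambda>i. 0) \<in> C"
  proof -
    obtain f where "f \<in> C" using Suc.prems(2) by auto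
    from closed[OF this this, of 1] show ?thesis by simp
  qed
  have add: "(\<lambda>i. f i + a * g i) \<in> C" if "f \<in> C" "g \<in> C" for f g a
    using closed[OF that, of "-a"] by simp
  have unit_test: "\<not> 0 < degree p" if "\<And>c. c \<in> C \<Longrightarrow> p dvd c m" for p
  proof
    assume p: "0 < degree p"
    have "\<forall>i<Suc m. p dvd (if i = m then 1 else 0)"
      by (rule sat[OF p]) (use that in auto)
    then have "p dvd 1" by auto
    then have "degree p \<le> degree (1 :: 'a poly)" by (rule dvd_imp_degree_le) simp
    then show False using p by simp
  qed
  have "\<exists>c\<in>C. c m \<noteq> 0"
  proof (rule ccontr)
    assume "\<not> ?thesis"
    \<comment> \<open>If every last coordinate were zero, the nonconstant polynomial
      \<open>[:0, 1:]\<close> would divide all of them.\<close>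
    then have "\<not> 0 < degree [:0, 1 :: 'a:]" by (intro unit_test) auto
    then show False by simp
  qed
  then obtain g where g: "g \<in> C" "g m \<noteq> 0"
    and least: "\<And>c. c \<in> C \<Longrightarrow> c m \<noteq> 0 \<Longrightarrow> degree (g m) \<le> degree (c m)"
    using ex_has_least_nat[of "\<lambda>c. c \<in> C \<and> c m \<noteq> 0" _ "\<lambda>c. degree (c m)"] by blast
  \<comment> \<open>Division with remainder: the remainder is again the last coordinate of an
    element of \<open>C\<close>, so the minimal degree of \<open>g m\<close> forces it to
    vanish.\<close>
  have "g m dvd c m" if "c \<in> C" for c
  proof (rule ccontr)
    assume "\<not> g m dvd c m"
    then have ne: "c m mod g m \<noteq> 0" by (simp add: dvd_eq_mod_eq_0)
    have "(\<lambda>i. c i - (c m div g m) * g i) \<in> C" using closed[OF that g(1)] .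
    from least[OF this] have "degree (g m) \<le> degree (c m mod g m)"
      using ne by (simp add: minus_div_mult_eq_mod)
    then show False using degree_mod_less[OF g(2), of "c m"] ne by simp
  qed
  then have "degree (g m) = 0" using unit_test by blast
  then obtain b where b: "g m = [:b:]" "b \<noteq> 0" using g(2) by (metis degree_eq_zeroE pCons_0_0)
  define e where "e = (\<lambda>i. 0 + [:inverse b:] * g i)"
  have "e \<in> C" unfolding e_def by (rule add[OF zero g(1)])
  moreover have "e m = 1" using b by (simp add: e_def one_pCons)
  ultimately have e: "e \<in> C" "e m = 1" .
  define C' where "C' = {c \<in> C. c m = 0}"
  \<comment> \<open>The multiple \<open>v m * e\<close> settles the last coordinate; the induction
    hypothesis supplies the difference, whose last coordinate is 0.\<close>
  have "\<exists>c\<in>C'. \<forall>i<m. c i = v i - v m * e i"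
  proof (rule Suc.IH)
    show "(\<lambda>i. f i - a * g i) \<in> C'" if "f \<in> C'" "g \<in> C'" for f g a
      using that closed by (auto simp: C'_def)
    show "C' \<noteq> {}" using zero by (auto simp: C'_def)
    fix p :: "'a poly" and w
    assume p: "0 < degree p" and dvd: "\<And>c. c \<in> C' \<Longrightarrow> p dvd (\<Sum>i<m. w i * c i)"
    \<comment> \<open>The last entry makes the pairing of \<open>w'\<close> with \<open>e\<close>
      zero. Hence pairing \<open>w'\<close> with \<open>c\<close> equals pairing \<open>w\<close>
      with \<open>c - c m * e\<close>, which lies in \<open>C'\<close>.\<close>
    define w' where "w' = w(m := - (\<Sum>i<m. w i * e i))"
    have "\<forall>i<Suc m. p dvd w' i"
    proof (rule sat[OF p])
      fix c assume c: "c \<in> C"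
      have "(\<lambda>i. c i - c m * e i) \<in> C'" using closed[OF c e(1)] e(2) by (auto simp: C'_def)
      from dvd[OF this] have "p dvd (\<Sum>i<m. w i * (c i - c m * e i))" .
      also have "\<dots> = (\<Sum>i<Suc m. w' i * c i)"
        by (simp add: w'_def algebra_simps sum_subtractf sum_distrib_left)
      finally show "p dvd (\<Sum>i<Suc m. w' i * c i)" .
    qed
    then show "\<forall>i<m. p dvd w i" by (auto simp: w'_def split: if_splits) (metis less_SucI less_irrefl)
  qed
  then obtain c where c: "c \<in> C" "c m = 0" "\<And>i. i < m \<Longrightarrow> c i = v i - v m * e i"
    by (auto simp: C'_def)
  show ?case
  proof (rule bexI)
    show "(\<lambda>i. c i + v m * e i) \<in> C" by (rule add[OF c(1) e(1)])
    show "\<forall>i<Suc m. c i + v m * e i = v i" using c(2,3) e(2) by (simp add: less_Suc_eq)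
  qed
qed

text \<open>For irreducible \<open>p\<close> this is full row rank over the residue field modulo
  \<open>p\<close>, that is, at the roots of \<open>p\<close> in the algebraic closure. Stating it
  for all nonconstant \<open>p\<close> keeps factorization out of the arguments.\<close>

definition saturated :: "'a::field poly mat \<Rightarrow> bool" where
  "saturated K \<longleftrightarrow> (\<forall>p w. 0 < degree p \<longrightarrow>
     (\<forall>j<dim_col K. p dvd (\<Sum>i<dim_row K. w i * K $$ (i, j))) \<longrightarrow> (\<forall>i<dim_row K. p dvd w i))"

text \<open>The module of all products of \<open>K\<close> with a column vector satisfies the
  hypotheses of \<open>saturated_submodule_full\<close>, so it contains every unit vector; preimages
  of these are the columns of \<open>B\<close>.\<close>

lemma saturated_right_inverse:
  fixes K :: "'a::field poly mat"
  assumes K: "K \<in> carrier_mat m n" and sat: "saturated K"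
  obtains B where "B \<in> carrier_mat n m" "K * B = 1\<^sub>m m"
proof -
  define C where "C = range (\<lambda>b i. \<Sum>j<n. K $$ (i, j) * b j)"
  have col: "\<exists>b. \<forall>i<m. (\<Sum>j<n. K $$ (i, j) * b j) = (if i = k then 1 else 0)" for k
  proof -
    have "\<exists>c\<in>C. \<forall>i<m. c i = (if i = k then 1 else 0)"
    proof (rule saturated_submodule_full)
      fix f g a assume "f \<in> C" "g \<in> C"
      then obtain b b' where "f = (\<lambda>i. \<Sum>j<n. K $$ (i, j) * b j)" "g = (\<lambda>i. \<Sum>j<n. K $$ (i, j) * b' j)"
        by (auto simp: C_def)
      then have "(\<lambda>i. f i - a * g i) = (\<lambda>i. \<Sum>j<n. K $$ (i, j) * (b j - a * b' j))"
        by (simp add: algebra_simps sum_subtractf sum_distrib_left)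
      then show "(\<lambda>i. f i - a * g i) \<in> C" by (auto simp: C_def)
    next
      show "C \<noteq> {}" by (simp add: C_def)
    next
      fix p :: "'a poly" and w
      assume p: "0 < degree p" and dvd: "\<And>c. c \<in> C \<Longrightarrow> p dvd (\<Sum>i<m. w i * c i)"
      have "p dvd (\<Sum>i<m. w i * K $$ (i, j))" if j: "j < n" for j
      proof -
        \<comment> \<open>The unit vector \<open>j\<close> puts column \<open>j\<close> of
          \<open>K\<close> into \<open>C\<close>, so divisibility on \<open>C\<close> gives
          divisibility of entry \<open>j\<close> of the combination \<open>w K\<close>.\<close>
        have eq: "(\<Sum>l<n. K $$ (i, l) * (if l = j then 1 else 0)) = K $$ (i, j)" for i
          using j by (simp add: if_distrib[of "(*) _"] cong: if_cong)
        have "(\<lambda>i. \<Sum>l<n. K $$ (i, l) * (if l = j then 1 else 0)) \<in> C" by (auto simp: C_def)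
        from dvd[OF this] show ?thesis unfolding eq .
      qed
      then show "\<forall>i<m. p dvd w i" using sat K p unfolding saturated_def by auto
    qed
    then show ?thesis by (auto simp: C_def)
  qed
  then obtain b where b: "\<And>k i. i < m \<Longrightarrow> (\<Sum>j<n. K $$ (i, j) * b k j) = (if i = k then 1 else 0)"
    by metis
  define B where "B = mat n m (\<lambda>(j, k). b k j)"
  have "K * B = 1\<^sub>m m"
    by (rule eq_matI) (use K b in \<open>auto simp: B_def scalar_prod_def atLeast0LessThan\<close>)
  moreover have "B \<in> carrier_mat n m" by (simp add: B_def)
  ultimately show thesis using that by blast
qed

text \<open>Reducing \<open>w\<close> modulo \<open>p\<close> changes the combination by a multiple
  of \<open>p\<close>, and the remainder of \<open>w i\<close> vanishes exactly when
  \<open>p\<close> divides \<open>w i\<close>. The degree bound gained on \<open>w\<close> drives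
  both saturation proofs.\<close>

lemma saturatedI_reduced:
  fixes K :: "'a::field poly mat"
  assumes "\<And>p w v i. 0 < degree p \<Longrightarrow> (\<And>k. degree (w k) < degree p) \<Longrightarrow>
      (\<And>j. j < dim_col K \<Longrightarrow> (\<Sum>k<dim_row K. w k * K $$ (k, j)) = p * v j) \<Longrightarrow>
      i < dim_row K \<Longrightarrow> w i = 0"
  shows "saturated K"
  unfolding saturated_def
proof (intro allI impI)
  fix p :: "'a poly" and w i
  assume p: "0 < degree p" and i: "i < dim_row K"
    and dvd: "\<forall>j<dim_col K. p dvd (\<Sum>k<dim_row K. w k * K $$ (k, j))"
  define r where "r k = w k mod p" for k
  have "p dvd (\<Sum>k<dim_row K. r k * K $$ (k, j))" if "j < dim_col K" for j
  proof -
    have "(\<Sum>k<dim_row K. r k * K $$ (k, j)) =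
      (\<Sum>k<dim_row K. w k * K $$ (k, j)) - p * (\<Sum>k<dim_row K. w k div p * K $$ (k, j))"
      unfolding r_def minus_mult_div_eq_mod[symmetric]
      by (simp add: algebra_simps sum_subtractf sum_distrib_left)
    then show ?thesis using dvd that by simp
  qed
  then have "\<forall>j. \<exists>v. j < dim_col K \<longrightarrow> (\<Sum>k<dim_row K. r k * K $$ (k, j)) = p * v" by (auto simp: dvd_def)
  then obtain v where v: "\<And>j. j < dim_col K \<Longrightarrow> (\<Sum>k<dim_row K. r k * K $$ (k, j)) = p * v j" by metis
  have "degree (r k) < degree p" for k
    using degree_mod_less'[of p "w k"] p by (cases "r k = 0"; cases "p = 0") (auto simp: r_def)
  then have "r i = 0" using assms[OF p _ v i] by blast
  then show "p dvd w i" by (simp add: r_def dvd_eq_mod_eq_0)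
qed

text \<open>Among the rows with nonzero coefficient take \<open>k\<close> of largest row degree. The
  exchange property gives some \<open>v j\<close> of at least that degree, so \<open>p * v j\<close>
  has degree at least \<open>degree p + row_degree K k\<close>, whereas every summand of the
  combination stays below this.\<close>

lemma minimal_basis_saturated:
  fixes K :: "'a::field poly mat"
  assumes min: "minimal_basis K"
  shows "saturated K"
proof (rule saturatedI_reduced)
  fix p :: "'a poly" and w v i
  assume p: "0 < degree p" and small: "\<And>k. degree (w k) < degree p"
    and eq: "\<And>j. j < dim_col K \<Longrightarrow> (\<Sum>k<dim_row K. w k * K $$ (k, j)) = p * v j"
    and i: "i < dim_row K"
  show "w i = 0"
  proof (rule ccontr)
    assume wi: "w i \<noteq> 0"
    let ?S = "{k. k < dim_row K \<and> w k \<noteq> 0}"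
    have "Max (row_degree K ` ?S) \<in> row_degree K ` ?S" using i wi by (intro Max_in) auto
    then obtain k where k: "k < dim_row K" "w k \<noteq> 0" "row_degree K k = Max (row_degree K ` ?S)" by auto
    have max: "row_degree K l \<le> row_degree K k" if "l \<in> ?S" for l
      unfolding k(3) using that by (intro Max_ge) auto
    have p0: "p \<noteq> 0" using p by auto
    obtain j where j: "j < dim_col K" "v j \<noteq> 0" "row_degree K k \<le> degree (v j)"
      using minimal_basis_exchange[OF min p0 k(1,2) eq] by blast
    have "degree (w l * K $$ (l, j)) < degree p + row_degree K k" if "l < dim_row K" for l
    proof (cases "w l = 0")
      case True
      then show ?thesis using p by simp
    next
      case False
      have "degree (w l * K $$ (l, j)) \<le> degree (w l) + degree (K $$ (l, j))" by (rule degree_mult_le)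
      also have "\<dots> < degree p + row_degree K k"
        using small[of l] max[of l] False that degree_le_row_degree[OF j(1), of l] by simp
      finally show ?thesis .
    qed
    then have "degree (\<Sum>l<dim_row K. w l * K $$ (l, j)) < degree p + row_degree K k"
      using p by (intro degree_sum_less) auto
    also have "\<dots> \<le> degree (p * v j)" using j p0 by (simp add: degree_mult_eq)
    finally show False using eq[OF j(1)] by simp
  qed
qed

subsection \<open>Reversal\<close>

lemma coeff_rev_poly: "coeff (rev_poly d p) k = (if k \<le> d then coeff p (d - k) else 0)"
proof -
  have "coeff (rev_poly d p) k = (\<Sum>i\<le>d. if d - i = k then coeff p i else 0)"
    by (simp add: rev_poly_def coeff_sum)
  also have "\<dots> = (\<Sum>i\<le>d. if i = d - k then (if k \<le> d then coeff p i else 0) else 0)"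
    by (intro sum.cong) auto
  also have "\<dots> = (if k \<le> d then coeff p (d - k) else 0)" by simp
  finally show ?thesis .
qed

lemma degree_rev_poly_le: "degree (rev_poly d p) \<le> d"
  by (rule degree_le) (simp add: coeff_rev_poly)

lemma rev_poly_0 [simp]: "rev_poly d 0 = 0"
  by (simp add: rev_poly_def)

lemma rev_poly_sum: "rev_poly d (\<Sum>i\<in>I. f i) = (\<Sum>i\<in>I. rev_poly d (f i))"
  by (rule poly_eqI) (simp add: coeff_rev_poly coeff_sum)

lemma rev_poly_rev_poly: "degree p \<le> d \<Longrightarrow> rev_poly d (rev_poly d p) = p"
  by (rule poly_eqI) (auto simp: coeff_rev_poly coeff_eq_0)

lemma rev_poly_eq_0_iff: "degree p \<le> d \<Longrightarrow> rev_poly d p = 0 \<longleftrightarrow> p = 0"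
  by (metis rev_poly_0 rev_poly_rev_poly)

text \<open>\<open>reflect_poly\<close> reverses at the actual degree, so a larger grade only
  contributes a power of the variable. Multiplicativity of \<open>rev_poly\<close> is inherited from
  \<open>reflect_poly\<close> in this way.\<close>

lemma rev_poly_reflect: "degree p \<le> d \<Longrightarrow> rev_poly d p = monom 1 (d - degree p) * reflect_poly p"
  by (rule poly_eqI) (auto simp: coeff_rev_poly coeff_monom_mult coeff_reflect_poly coeff_eq_0
      intro!: arg_cong[where f = "coeff p"])

lemma rev_poly_mult:
  assumes "degree p \<le> d" "degree q \<le> e"
  shows "rev_poly (d + e) (p * q) = rev_poly d p * rev_poly e q"
proof (cases "p = 0 \<or> q = 0")
  case False
  then have deg: "degree (p * q) = degree p + degree q" by (simp add: degree_mult_eq)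
  have "monom (1 :: 'a) (d + e - degree (p * q)) = monom 1 (d - degree p) * monom 1 (e - degree q)"
    using assms by (simp add: mult_monom deg)
  then show ?thesis
    using assms deg by (simp add: rev_poly_reflect reflect_poly_mult ac_simps)
qed auto

text \<open>Reversing the relation once more turns it into a relation between the rows of
  \<open>K\<close> itself, with right-hand side
  \<open>rev_poly (degree p) p * rev_poly (d - 1) (v j)\<close>. The exchange property then demands
  an entry of degree at least \<open>d\<close>, but \<open>rev_poly (d - 1)\<close> never reaches
  it.\<close>

lemma minimal_basis_rev_saturated:
  fixes K :: "'a::field poly mat"
  assumes min: "minimal_basis K" and deg: "\<And>i. i < dim_row K \<Longrightarrow> row_degree K i = d"
  shows "saturated (mpoly_rev d K)"
proof (rule saturatedI_reduced, unfold mpoly_rev_def index_map_mat(2,3))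
  fix p :: "'a poly" and w v i
  assume p: "0 < degree p" and small: "\<And>k. degree (w k) < degree p"
    and eq: "\<And>j. j < dim_col K \<Longrightarrow>
      (\<Sum>k<dim_row K. w k * map_mat (rev_poly d) K $$ (k, j)) = p * v j"
    and i: "i < dim_row K"
  \<comment> \<open>Since \<open>w\<close> has degree at most \<open>e\<close> and \<open>v\<close>
    degree at most \<open>d - 1\<close>, both sides are reversed at the same grade:
    \<open>e + d = degree p + (d - 1)\<close>.\<close>
  define e where "e = degree p - 1"
  have we: "degree (w k) \<le> e" for k using small[of k] by (simp add: e_def)
  have p0: "p \<noteq> 0" using p by auto
  \<comment> \<open>The left side of \<open>eq\<close> has degree below \<open>degree p + d\<close>,
    which bounds the cofactor of \<open>p\<close>.\<close>
  have vd: "v j = 0 \<or> degree (v j) < d" if j: "j < dim_col K" for j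
  proof (rule ccontr)
    assume neg: "\<not> ?thesis"
    have "degree (w k * rev_poly d (K $$ (k, j))) < degree p + d" for k
      using degree_mult_le[of "w k" "rev_poly d (K $$ (k, j))"] small[of k]
        degree_rev_poly_le[of d "K $$ (k, j)"] by linarith
    then have "degree (\<Sum>k<dim_row K. w k * map_mat (rev_poly d) K $$ (k, j)) < degree p + d"
      using p j by (intro degree_sum_less) auto
    also have "\<dots> \<le> degree (p * v j)" using neg p0 by (simp add: degree_mult_eq)
    finally show False using eq[OF j] by simp
  qed
  show "w i = 0"
  proof (rule ccontr)
    assume "w i \<noteq> 0"
    then have wi: "rev_poly e (w i) \<noteq> 0" using we[of i] by (simp add: rev_poly_eq_0_iff)
    have q: "rev_poly (degree p) p \<noteq> 0" using p0 by (simp add: rev_poly_eq_0_iff)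
    have "(\<Sum>k<dim_row K. rev_poly e (w k) * K $$ (k, j)) = rev_poly (degree p) p * rev_poly (d - 1) (v j)"
      if j: "j < dim_col K" for j
    proof -
      have "K $$ (k, j) = rev_poly d (rev_poly d (K $$ (k, j)))" if "k < dim_row K" for k
        using degree_le_row_degree[OF j, of k] deg[OF that] by (simp add: rev_poly_rev_poly)
      then have "(\<Sum>k<dim_row K. rev_poly e (w k) * K $$ (k, j)) =
        (\<Sum>k<dim_row K. rev_poly e (w k) * rev_poly d (rev_poly d (K $$ (k, j))))" by simp
      also have "\<dots> = rev_poly (e + d) (\<Sum>k<dim_row K. w k * map_mat (rev_poly d) K $$ (k, j))"
        using j by (simp add: rev_poly_sum rev_poly_mult[OF we degree_rev_poly_le])
      also have "\<dots> = rev_poly (e + d) (p * v j)" unfolding eq[OF j] ..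
      also have "\<dots> = rev_poly (degree p) p * rev_poly (d - 1) (v j)"
      proof (cases "v j = 0")
        case False
        then have "degree (v j) < d" using vd[OF j] by simp
        then have "e + d = degree p + (d - 1)" "degree (v j) \<le> d - 1" using p by (auto simp: e_def)
        then show ?thesis by (simp add: rev_poly_mult)
      qed simp
      finally show ?thesis .
    qed
    from minimal_basis_exchange[OF min q i wi this, unfolded deg[OF i]]
    obtain j where j: "j < dim_col K" "rev_poly (d - 1) (v j) \<noteq> 0" "d \<le> degree (rev_poly (d - 1) (v j))"
      by blast
    then have "v j \<noteq> 0" by auto
    \<comment> \<open>Positivity of \<open>d\<close> ensures that the truncated difference
      \<open>d - 1\<close> is really smaller than \<open>d\<close>.\<close>
    then have "0 < d" using vd[OF j(1)] by auto
    then show False using j(3) degree_rev_poly_le[of "d - 1" "v j"] by simp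
  qed
qed

subsection \<open>Unimodular equivalence\<close>

text \<open>A one-sided polynomial inverse makes the determinant a unit of the polynomial ring, that
  is, a nonzero constant.\<close>

lemma unimodularI:
  fixes U :: "'a::field poly mat"
  assumes "U \<in> carrier_mat n n" "W \<in> carrier_mat n n" "U * W = 1\<^sub>m n \<or> W * U = 1\<^sub>m n"
  shows "unimodular U"
proof -
  have "det U * det W = 1"
    using det_mult[OF assms(1,2)] det_mult[OF assms(2,1)] assms(3) by (auto simp: mult.commute)
  then have "is_unit (det U)" by (metis dvd_triv_left)
  then obtain c where c: "det U = [:c:]" "c dvd 1" unfolding is_unit_poly_iff by blast
  then have "c \<noteq> 0" by auto
  moreover have "square_mat U" using assms(1) by simp
  ultimately show ?thesis using c(1) unfolding unimodular_def by blast
qed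

lemma unimodularD:
  assumes "unimodular U"
  obtains c where "U \<in> carrier_mat (dim_row U) (dim_row U)" "c \<noteq> 0" "det U = [:c:]"
proof -
  obtain c where "c \<noteq> 0" "det U = [:c:]" using assms unfolding unimodular_def by blast
  moreover have "U \<in> carrier_mat (dim_row U) (dim_row U)"
    using assms unfolding unimodular_def by (intro carrier_matI) simp_all
  ultimately show thesis using that by blast
qed

lemma unimodular_mult:
  fixes U W :: "'a::field poly mat"
  assumes "unimodular U" "unimodular W" "dim_row U = dim_row W"
  shows "unimodular (U * W)"
proof -
  obtain c where U: "U \<in> carrier_mat (dim_row U) (dim_row U)" "c \<noteq> 0" "det U = [:c:]"
    using unimodularD[OF assms(1)] .
  obtain d where W: "W \<in> carrier_mat (dim_row U) (dim_row U)" "d \<noteq> 0" "det W = [:d:]"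
    using unimodularD[OF assms(2)] assms(3) by metis
  have "det (U * W) = [:c * d:]" unfolding det_mult[OF U(1) W(1)] U(3) W(3) by simp
  moreover have "square_mat (U * W)" using carrier_matD(2)[OF W(1)] by simp
  ultimately show ?thesis unfolding unimodular_def using U(2) W(2) by (metis mult_eq_0_iff)
qed

lemma unimodular_transpose:
  assumes "unimodular U"
  shows "unimodular U\<^sup>T"
proof -
  obtain c where U: "U \<in> carrier_mat (dim_row U) (dim_row U)" "c \<noteq> 0" "det U = [:c:]"
    using unimodularD[OF assms] .
  have "det U\<^sup>T = [:c:]" unfolding det_transpose[OF U(1)] by (rule U(3))
  moreover have "square_mat U\<^sup>T" using carrier_matD(2)[OF U(1)] by simp
  ultimately show ?thesis unfolding unimodular_def using U(2) by blast
qed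

lemma unimodular_diag_one:
  fixes U :: "'a::field poly mat"
  assumes "unimodular U" "U \<in> carrier_mat n n"
  shows "unimodular (four_block_mat (1\<^sub>m s) (0\<^sub>m s n) (0\<^sub>m n s) U)"
proof -
  obtain c where U: "c \<noteq> 0" "det U = [:c:]" using unimodularD[OF assms(1)] .
  have "det (four_block_mat (1\<^sub>m s) (0\<^sub>m s n) (0\<^sub>m n s) U) = [:c:]"
    by (subst det_four_block_mat_upper_right_zero[of _ s _ n]) (use assms U in auto)
  moreover have "square_mat (four_block_mat (1\<^sub>m s) (0\<^sub>m s n) (0\<^sub>m n s) U)" using assms by simp
  ultimately show ?thesis unfolding unimodular_def using U(1) by blast
qed

text \<open>The shape copies the existential part of \<open>linearization\<close>, with an arbitrary
  target, so that reductions can be chained and transposed.\<close>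

definition unimodular_equivalent :: "'a::field poly mat \<Rightarrow> 'a poly mat \<Rightarrow> bool" where
  "unimodular_equivalent P R \<longleftrightarrow> (\<exists>U V. unimodular U \<and> unimodular V \<and>
     dim_row U = dim_row P \<and> dim_row V = dim_col P \<and> U * P * V = R)"

lemma unimodular_equivalentE:
  fixes P :: "'a::field poly mat"
  assumes "unimodular_equivalent P R"
  obtains U V where "unimodular U" "unimodular V"
    "U \<in> carrier_mat (dim_row P) (dim_row P)" "V \<in> carrier_mat (dim_col P) (dim_col P)"
    "R = U * P * V" "R \<in> carrier_mat (dim_row P) (dim_col P)"
proof -
  obtain U V where 1: "unimodular U" "unimodular V" "dim_row U = dim_row P" "dim_row V = dim_col P"
    "U * P * V = R"
    using assms unfolding unimodular_equivalent_def by blast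
  have U: "U \<in> carrier_mat (dim_row P) (dim_row P)" and V: "V \<in> carrier_mat (dim_col P) (dim_col P)"
    using unimodularD[OF 1(1)] unimodularD[OF 1(2)] 1(3,4) by metis+
  show thesis by (rule that[OF 1(1,2) U V]) (use 1 U V in auto)
qed

lemma unimodular_equivalent_trans:
  fixes P :: "'a::field poly mat"
  assumes "unimodular_equivalent P R" "unimodular_equivalent R S"
  shows "unimodular_equivalent P S"
proof -
  obtain U V where 1: "unimodular U" "unimodular V" "U \<in> carrier_mat (dim_row P) (dim_row P)"
    "V \<in> carrier_mat (dim_col P) (dim_col P)" "R = U * P * V" "R \<in> carrier_mat (dim_row P) (dim_col P)"
    using unimodular_equivalentE[OF assms(1)] .
  obtain U' V' where 2: "unimodular U'" "unimodular V'" "U' \<in> carrier_mat (dim_row P) (dim_row P)"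
    "V' \<in> carrier_mat (dim_col P) (dim_col P)" "S = U' * R * V'"
    using unimodular_equivalentE[OF assms(2)] 1(6) by (metis carrier_matD)
  have "S = (U' * U) * P * (V * V')"
  proof -
    have P: "P \<in> carrier_mat (dim_row P) (dim_col P)" by simp
    have UP: "U * P \<in> carrier_mat (dim_row P) (dim_col P)" using 1(3) by simp
    have "U' * (U * P * V) = U' * (U * P) * V" by (rule assoc_mult_mat[OF 2(3) UP 1(4), symmetric])
    also have "U' * (U * P) = U' * U * P" by (rule assoc_mult_mat[OF 2(3) 1(3) P, symmetric])
    also have "U' * U * P * V * V' = U' * U * P * (V * V')"
      by (rule assoc_mult_mat) (use 1 2 in auto)
    finally show ?thesis unfolding 2(5) 1(5) .
  qed
  moreover have "unimodular (U' * U)" "unimodular (V * V')"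
    using 1 2 by (auto intro!: unimodular_mult)
  ultimately show ?thesis unfolding unimodular_equivalent_def using 1 2
    by (intro exI[of _ "U' * U"] exI[of _ "V * V'"]) auto
qed

lemma unimodular_equivalent_transpose:
  fixes P :: "'a::field poly mat"
  assumes "unimodular_equivalent P R"
  shows "unimodular_equivalent P\<^sup>T R\<^sup>T"
proof -
  obtain U V where 1: "unimodular U" "unimodular V" "U \<in> carrier_mat (dim_row P) (dim_row P)"
    "V \<in> carrier_mat (dim_col P) (dim_col P)" "R = U * P * V"
    using unimodular_equivalentE[OF assms] .
  have "R\<^sup>T = V\<^sup>T * (U * P)\<^sup>T"
    unfolding 1(5) by (rule transpose_mult) (use 1 in auto)
  also have "(U * P)\<^sup>T = P\<^sup>T * U\<^sup>T" by (rule transpose_mult) (use 1 in auto)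
  also have "V\<^sup>T * (P\<^sup>T * U\<^sup>T) = V\<^sup>T * P\<^sup>T * U\<^sup>T"
    by (rule assoc_mult_mat[symmetric]) (use 1 in auto)
  finally show ?thesis unfolding unimodular_equivalent_def
    using 1 by (intro exI[of _ "V\<^sup>T"] exI[of _ "U\<^sup>T"]) (auto simp: unimodular_transpose)
qed

lemma unimodular_equivalent_diag_one:
  fixes P :: "'a::field poly mat"
  assumes "unimodular_equivalent P R"
  shows "unimodular_equivalent
    (four_block_mat (1\<^sub>m s) (0\<^sub>m s (dim_col P)) (0\<^sub>m (dim_row P) s) P)
    (four_block_mat (1\<^sub>m s) (0\<^sub>m s (dim_col P)) (0\<^sub>m (dim_row P) s) R)"
proof -
  let ?m = "dim_row P" and ?n = "dim_col P"
  obtain U V where 1: "unimodular U" "unimodular V" "U \<in> carrier_mat ?m ?m"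
    "V \<in> carrier_mat ?n ?n" "R = U * P * V"
    using unimodular_equivalentE[OF assms] .
  have P: "P \<in> carrier_mat ?m ?n" by simp
  define U' where "U' = four_block_mat (1\<^sub>m s) (0\<^sub>m s ?m) (0\<^sub>m ?m s) U"
  define V' where "V' = four_block_mat (1\<^sub>m s) (0\<^sub>m s ?n) (0\<^sub>m ?n s) V"
  have a: "U' * four_block_mat (1\<^sub>m s) (0\<^sub>m s ?n) (0\<^sub>m ?m s) P =
    four_block_mat (1\<^sub>m s) (0\<^sub>m s ?n) (0\<^sub>m ?m s) (U * P)"
    unfolding U'_def
    by (subst mult_four_block_mat[where ?nr1.0 = s and ?n1.0 = s and ?nr2.0 = ?m and ?n2.0 = ?m and ?nc1.0 = s and ?nc2.0 = ?n])
      (use 1 in auto)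
  have b: "four_block_mat (1\<^sub>m s) (0\<^sub>m s ?n) (0\<^sub>m ?m s) (U * P) * V' =
    four_block_mat (1\<^sub>m s) (0\<^sub>m s ?n) (0\<^sub>m ?m s) (U * P * V)"
    unfolding V'_def
    by (subst mult_four_block_mat[where ?nr1.0 = s and ?n1.0 = s and ?nr2.0 = ?m and ?n2.0 = ?n and ?nc1.0 = s and ?nc2.0 = ?n])
      (use 1 in auto)
  have "unimodular U'" "unimodular V'" unfolding U'_def V'_def using 1 by (auto intro!: unimodular_diag_one)
  then show ?thesis unfolding unimodular_equivalent_def using a b 1
    by (intro exI[of _ U'] exI[of _ V']) (auto simp: U'_def V'_def)
qed

section \<open>Complementary pairs and reduction of the block pencil\<close>

text \<open>The four product equations say that the matrix with row blocks \<open>K\<close>,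
  \<open>D\<close> times the matrix with column blocks \<open>B\<close>, \<open>N\<^sup>T\<close> is
  the identity. Minimality is left out so that empty blocks and reversed bases are covered as
  well.\<close>

definition complementary :: "'a::field poly mat \<Rightarrow> 'a poly mat \<Rightarrow> bool" where
  "complementary K N \<longleftrightarrow> dim_col K = dim_col N \<and> dim_row K + dim_row N = dim_col K \<and>
     K * N\<^sup>T = 0\<^sub>m (dim_row K) (dim_row N) \<and>
     (\<exists>B D. B \<in> carrier_mat (dim_col K) (dim_row K) \<and> D \<in> carrier_mat (dim_row N) (dim_col K) \<and>
        K * B = 1\<^sub>m (dim_row K) \<and> D * B = 0\<^sub>m (dim_row N) (dim_row K) \<and> D * N\<^sup>T = 1\<^sub>m (dim_row N))"

text \<open>\<open>C\<^sup>T\<close> serves as \<open>D\<close>. Subtracting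
  \<open>N\<^sup>T * (C\<^sup>T * B)\<close> from \<open>B\<close> achieves
  \<open>C\<^sup>T * B' = 0\<close>, and \<open>K * N\<^sup>T = 0\<close> keeps \<open>B'\<close> a
  right inverse of \<open>K\<close>.\<close>

lemma complementaryI:
  fixes K N :: "'a::field poly mat"
  assumes K: "K \<in> carrier_mat m n" and N: "N \<in> carrier_mat r n" and n: "m + r = n"
    and KN: "K * N\<^sup>T = 0\<^sub>m m r"
    and B: "B \<in> carrier_mat n m" "K * B = 1\<^sub>m m" and C: "C \<in> carrier_mat n r" "N * C = 1\<^sub>m r"
  shows "complementary K N"
proof -
  define B' where "B' = B - N\<^sup>T * (C\<^sup>T * B)"
  have [simp]: "0\<^sub>m m r * (C\<^sup>T * B) = 0\<^sub>m m m" using B C by (intro left_mult_zero_mat) auto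
  have CN: "C\<^sup>T * N\<^sup>T = 1\<^sub>m r" using transpose_mult[OF N C(1)] C(2) by simp
  have NT: "N\<^sup>T \<in> carrier_mat n r" and CT: "C\<^sup>T \<in> carrier_mat r n" using N C by auto
  have CB: "C\<^sup>T * B \<in> carrier_mat r m" using CT B by auto
  have "K * B' = K * B - K * N\<^sup>T * (C\<^sup>T * B)"
    unfolding B'_def using mult_minus_distrib_mat[OF K B(1), of "N\<^sup>T * (C\<^sup>T * B)"] assoc_mult_mat[OF K NT CB] NT CB
    by auto
  then have 1: "K * B' = 1\<^sub>m m" unfolding B(2) KN using CB by auto
  have "C\<^sup>T * B' = C\<^sup>T * B - C\<^sup>T * N\<^sup>T * (C\<^sup>T * B)"
    unfolding B'_def using mult_minus_distrib_mat[OF CT B(1), of "N\<^sup>T * (C\<^sup>T * B)"] assoc_mult_mat[OF CT NT CB] NT CB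
    by auto
  then have 2: "C\<^sup>T * B' = 0\<^sub>m r m" unfolding CN left_mult_one_mat[OF CB] using CB by auto
  have "B' \<in> carrier_mat n m" unfolding B'_def by (intro minus_carrier_mat mult_carrier_mat[OF NT CB])
  then have "\<exists>B D. B \<in> carrier_mat n m \<and> D \<in> carrier_mat r n \<and>
    K * B = 1\<^sub>m m \<and> D * B = 0\<^sub>m r m \<and> D * N\<^sup>T = 1\<^sub>m r"
    using 1 2 CN CT by blast
  then show ?thesis unfolding complementary_def using K N n KN by simp
qed

text \<open>Row operations replace \<open>A\<close> by \<open>A - A * B * K\<close>, which
  annihilates \<open>B\<close> from the right and agrees with \<open>A\<close> on
  \<open>N\<^sup>T\<close>. Multiplying on the right by the matrix with column blocks
  \<open>B\<close>, \<open>N\<^sup>T\<close> then leaves only \<open>A * N\<^sup>T\<close> beside an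
  identity.\<close>

lemma complementary_stack_equivalent:
  fixes K N A :: "'a::field poly mat"
  assumes comp: "complementary K N" and A: "A \<in> carrier_mat a (dim_col K)"
  shows "unimodular_equivalent (A @\<^sub>r K)
    (four_block_mat (1\<^sub>m (dim_row K)) (0\<^sub>m (dim_row K) (dim_row N)) (0\<^sub>m a (dim_row K)) (A * N\<^sup>T))"
proof -
  define m n r where "m = dim_row K" and "n = dim_col K" and "r = dim_row N"
  have K: "K \<in> carrier_mat m n" and N: "N \<in> carrier_mat r n" and NT: "N\<^sup>T \<in> carrier_mat n r"
    and n: "m + r = n" and KN: "K * N\<^sup>T = 0\<^sub>m m r" and A: "A \<in> carrier_mat a n"
    using comp A by (auto simp: complementary_def m_def n_def r_def)
  obtain B D where B: "B \<in> carrier_mat n m" and D: "D \<in> carrier_mat r n" and KB: "K * B = 1\<^sub>m m"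
    and DB: "D * B = 0\<^sub>m r m" and DN: "D * N\<^sup>T = 1\<^sub>m r"
    using comp by (auto simp: complementary_def m_def n_def r_def)
  define G where "G = A * B"
  have G: "G \<in> carrier_mat a m" unfolding G_def using A B by auto
  have GG: "G + - G = 0\<^sub>m a m" and AGK: "A + - G * K = A - G * K"
    by (rule eq_matI; use G A K in simp)+
  \<comment> \<open>Blocks without rows or columns let \<open>four_block_mat\<close> describe
    matrices made of just two blocks.\<close>
  define V where "V = four_block_mat B N\<^sup>T (0\<^sub>m 0 m) (0\<^sub>m 0 r)"
  define W where "W = four_block_mat K (0\<^sub>m m 0) D (0\<^sub>m r 0)"
  \<comment> \<open>\<open>U\<close> exchanges the two block rows and subtracts \<open>G\<close>
    times \<open>K\<close> from \<open>A\<close>; \<open>U'\<close> undoes this.\<close>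
  define U where "U = four_block_mat (0\<^sub>m m a) (1\<^sub>m m) (1\<^sub>m a) (- G)"
  define U' where "U' = four_block_mat G (1\<^sub>m a) (1\<^sub>m m) (0\<^sub>m m a)"
  have Vc: "V \<in> carrier_mat n n" and Wc: "W \<in> carrier_mat n n"
    unfolding V_def W_def using B NT K D n by auto
  have Uc: "U \<in> carrier_mat (a + m) (a + m)" and U'c: "U' \<in> carrier_mat (a + m) (a + m)"
    by (rule carrier_matI; use G in \<open>simp add: U_def U'_def\<close>)+
  have "W * V = four_block_mat (1\<^sub>m m) (0\<^sub>m m r) (0\<^sub>m r m) (1\<^sub>m r)"
    unfolding W_def V_def
    by (subst mult_four_block_mat[OF K _ D _ B NT]) (use K N D B KB KN DB DN in auto)
  then have "W * V = 1\<^sub>m n" unfolding n[symmetric] by simp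
  then have uV: "unimodular V" using unimodularI[OF Vc Wc] by simp
  have "U * U' = four_block_mat (1\<^sub>m m) (0\<^sub>m m a) (0\<^sub>m a m) (1\<^sub>m a)"
    unfolding U_def U'_def
    by (subst mult_four_block_mat[where ?nr1.0 = m and ?n1.0 = a and ?nr2.0 = a and ?n2.0 = m and ?nc1.0 = m and ?nc2.0 = a])
      (use G GG in auto)
  then have "U * U' = 1\<^sub>m (a + m)" by (simp add: add.commute)
  then have uU: "unimodular U" using unimodularI[OF Uc U'c] by simp
  have X: "A - G * K \<in> carrier_mat a n" using A G K by auto
  have "U * (A @\<^sub>r K) = four_block_mat K (0\<^sub>m m 0) (A - G * K) (0\<^sub>m a 0)"
    unfolding U_def append_rows_def
    by (subst mult_four_block_mat[where ?nr1.0 = m and ?n1.0 = a and ?nr2.0 = a and ?n2.0 = m and ?nc1.0 = n and ?nc2.0 = 0])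
      (use A K G AGK in auto)
  moreover have "four_block_mat K (0\<^sub>m m 0) (A - G * K) (0\<^sub>m a 0) * V =
    four_block_mat (1\<^sub>m m) (0\<^sub>m m r) (0\<^sub>m a m) (A * N\<^sup>T)"
  proof -
    have "(A - G * K) * B = G - G * (K * B)"
      using minus_mult_distrib_mat[OF A mult_carrier_mat[OF G K] B] assoc_mult_mat[OF G K B]
      by (simp add: G_def)
    then have 1: "(A - G * K) * B = 0\<^sub>m a m" unfolding KB using G by auto
    have "(A - G * K) * N\<^sup>T = A * N\<^sup>T - G * (K * N\<^sup>T)"
      using minus_mult_distrib_mat[OF A mult_carrier_mat[OF G K] NT] assoc_mult_mat[OF G K NT]
      by simp
    then have 2: "(A - G * K) * N\<^sup>T = A * N\<^sup>T" unfolding KN using G A NT by auto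
    show ?thesis unfolding V_def
      by (subst mult_four_block_mat[OF K _ X _ B NT]) (use KB KN 1 2 A NT in auto)
  qed
  ultimately have "U * (A @\<^sub>r K) * V = four_block_mat (1\<^sub>m m) (0\<^sub>m m r) (0\<^sub>m a m) (A * N\<^sup>T)" by simp
  then show ?thesis unfolding unimodular_equivalent_def m_def[symmetric] r_def[symmetric]
    using uU uV Uc Vc A K by (intro exI[of _ U] exI[of _ V] conjI) (auto simp: append_rows_def)
qed

text \<open>The lower block row of the pencil is \<open>K1\<close> padded by zero columns. The added
  coordinates are free, so the complement grows by an identity block.\<close>

lemma complementary_extend:
  fixes K N :: "'a::field poly mat"
  assumes comp: "complementary K N"
    and K: "K \<in> carrier_mat m n" and N: "N \<in> carrier_mat r n"
  shows "complementary (four_block_mat K (0\<^sub>m m c) (0\<^sub>m 0 n) (0\<^sub>m 0 c))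
    (four_block_mat N (0\<^sub>m r c) (0\<^sub>m c n) (1\<^sub>m c))" (is "complementary ?K ?N")
proof -
  have n: "m + r = n" and KN: "K * N\<^sup>T = 0\<^sub>m m r" and NT: "N\<^sup>T \<in> carrier_mat n r"
    using comp K N by (auto simp: complementary_def)
  obtain B D where B: "B \<in> carrier_mat n m" and D: "D \<in> carrier_mat r n" and KB: "K * B = 1\<^sub>m m"
    and DB: "D * B = 0\<^sub>m r m" and DN: "D * N\<^sup>T = 1\<^sub>m r"
    using comp K N by (auto simp: complementary_def)
  let ?B = "four_block_mat B (0\<^sub>m n 0) (0\<^sub>m c m) (0\<^sub>m c 0)"
  let ?D = "four_block_mat D (0\<^sub>m r c) (0\<^sub>m c n) (1\<^sub>m c)"
  have NTb: "?N\<^sup>T = four_block_mat N\<^sup>T (0\<^sub>m n c) (0\<^sub>m c r) (1\<^sub>m c)"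
    by (subst transpose_four_block_mat[OF N]) auto
  have "?K * ?N\<^sup>T = four_block_mat (0\<^sub>m m r) (0\<^sub>m m c) (0\<^sub>m 0 r) (0\<^sub>m 0 c)"
    unfolding NTb by (subst mult_four_block_mat[OF K _ _ _ NT]) (use K N KN in auto)
  also have "\<dots> = 0\<^sub>m m (r + c)" by (rule eq_matI) auto
  finally have 1: "?K * ?N\<^sup>T = 0\<^sub>m m (r + c)" .
  have "?K * ?B = four_block_mat (1\<^sub>m m) (0\<^sub>m m 0) (0\<^sub>m 0 m) (0\<^sub>m 0 0)"
    by (subst mult_four_block_mat[OF K _ _ _ B]) (use K B KB in auto)
  also have "\<dots> = 1\<^sub>m m" by (rule eq_matI) auto
  finally have 2: "?K * ?B = 1\<^sub>m m" .
  have "?D * ?B = four_block_mat (0\<^sub>m r m) (0\<^sub>m r 0) (0\<^sub>m c m) (0\<^sub>m c 0)"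
    by (subst mult_four_block_mat[OF D _ _ _ B]) (use D B DB in auto)
  also have "\<dots> = 0\<^sub>m (r + c) m" by (rule eq_matI) auto
  finally have 3: "?D * ?B = 0\<^sub>m (r + c) m" .
  have "?D * ?N\<^sup>T = four_block_mat (1\<^sub>m r) (0\<^sub>m r c) (0\<^sub>m c r) (1\<^sub>m c)"
    unfolding NTb by (subst mult_four_block_mat[OF D _ _ _ NT]) (use D N DN in auto)
  then have 4: "?D * ?N\<^sup>T = 1\<^sub>m (r + c)" by simp
  have Kc: "?K \<in> carrier_mat m (n + c)" using four_block_carrier_mat[OF K, of "0\<^sub>m 0 c" 0 c] by simp
  have Nc: "?N \<in> carrier_mat (r + c) (n + c)" using four_block_carrier_mat[OF N, of "1\<^sub>m c" c c] by simp
  have Bc: "?B \<in> carrier_mat (n + c) m" using four_block_carrier_mat[OF B, of "0\<^sub>m c 0" c 0] by simp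
  have Dc: "?D \<in> carrier_mat (r + c) (n + c)" using four_block_carrier_mat[OF D, of "1\<^sub>m c" c c] by simp
  show ?thesis
    unfolding complementary_def carrier_matD[OF Kc] carrier_matD[OF Nc] using 1 2 3 4 Bc Dc n
    by (intro conjI exI[of _ ?B] exI[of _ ?D]) simp_all
qed

text \<open>The first reduction uses the padded \<open>K1\<close> below \<open>A\<close> and leaves
  \<open>P\<close>, with column blocks \<open>M * N1\<^sup>T\<close> and \<open>K2\<^sup>T\<close>.
  Transposing \<open>P\<close> puts \<open>K2\<close> at the bottom of a stack, where the same
  reduction applies.\<close>

lemma block_pencil_equivalent:
  fixes K1 N1 K2 N2 M :: "'a::field poly mat"
  assumes comp1: "complementary K1 N1" and comp2: "complementary K2 N2"
    and M: "M \<in> carrier_mat (dim_col K2) (dim_col K1)"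
  shows "unimodular_equivalent (block_pencil M K1 K2)
    (four_block_mat (1\<^sub>m (dim_row K1 + dim_row K2)) (0\<^sub>m (dim_row K1 + dim_row K2) (dim_row N1))
      (0\<^sub>m (dim_row N2) (dim_row K1 + dim_row K2)) (N2 * M * N1\<^sup>T))"
proof -
  define m1 n1 r1 m2 n2 r2 where "m1 = dim_row K1" and "n1 = dim_col K1" and "r1 = dim_row N1"
    and "m2 = dim_row K2" and "n2 = dim_col K2" and "r2 = dim_row N2"
  note defs = m1_def n1_def r1_def m2_def n2_def r2_def
  have K1: "K1 \<in> carrier_mat m1 n1" and N1: "N1 \<in> carrier_mat r1 n1"
    and K2: "K2 \<in> carrier_mat m2 n2" and N2: "N2 \<in> carrier_mat r2 n2" and M: "M \<in> carrier_mat n2 n1"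
    using comp1 comp2 M by (auto simp: complementary_def defs)
  have N1T: "N1\<^sup>T \<in> carrier_mat n1 r1" and K2T: "K2\<^sup>T \<in> carrier_mat n2 m2" using N1 K2 by auto
  define G where "G = M * N1\<^sup>T"
  have G: "G \<in> carrier_mat n2 r1" unfolding G_def by (rule mult_carrier_mat[OF M N1T])
  define A where "A = four_block_mat M K2\<^sup>T (0\<^sub>m 0 n1) (0\<^sub>m 0 m2)"
  define K where "K = four_block_mat K1 (0\<^sub>m m1 m2) (0\<^sub>m 0 n1) (0\<^sub>m 0 m2)"
  define N where "N = four_block_mat N1 (0\<^sub>m r1 m2) (0\<^sub>m m2 n1) (1\<^sub>m m2)"
  define P where "P = four_block_mat G K2\<^sup>T (0\<^sub>m 0 r1) (0\<^sub>m 0 m2)"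
  define Q where "Q = N2 * M * N1\<^sup>T"
  have A: "A \<in> carrier_mat n2 (n1 + m2)"
    unfolding A_def using four_block_carrier_mat[OF M, of "0\<^sub>m 0 m2" 0 m2] by simp
  have K: "K \<in> carrier_mat m1 (n1 + m2)"
    unfolding K_def using four_block_carrier_mat[OF K1, of "0\<^sub>m 0 m2" 0 m2] by simp
  have N: "N \<in> carrier_mat (r1 + m2) (n1 + m2)"
    unfolding N_def using four_block_carrier_mat[OF N1, of "1\<^sub>m m2" m2 m2] by simp
  have P: "P \<in> carrier_mat n2 (r1 + m2)"
    unfolding P_def using four_block_carrier_mat[OF G, of "0\<^sub>m 0 m2" 0 m2] by simp
  have L: "block_pencil M K1 K2 = A @\<^sub>r K"
    unfolding block_pencil_def append_rows_def
    by (rule eq_matI) (use M K1 K2 in \<open>auto simp: A_def K_def\<close>)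
  have NTb: "N\<^sup>T = four_block_mat N1\<^sup>T (0\<^sub>m n1 m2) (0\<^sub>m m2 r1) (1\<^sub>m m2)"
    unfolding N_def by (subst transpose_four_block_mat[OF N1]) auto
  have AN: "A * N\<^sup>T = P"
    unfolding NTb A_def P_def
    by (subst mult_four_block_mat[OF M K2T _ _ N1T]) (use M K2T N1T G in \<open>auto simp: G_def\<close>)
  have "complementary K N" unfolding K_def N_def by (rule complementary_extend[OF comp1 K1 N1])
  from complementary_stack_equivalent[OF this, of A n2]
  have step1: "unimodular_equivalent (A @\<^sub>r K)
    (four_block_mat (1\<^sub>m m1) (0\<^sub>m m1 (r1 + m2)) (0\<^sub>m n2 m1) P)"
    unfolding AN using A carrier_matD[OF K] carrier_matD[OF N] by simp
  have Q: "(G\<^sup>T * N2\<^sup>T)\<^sup>T = Q"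
    unfolding Q_def assoc_mult_mat[OF N2 M N1T] G_def[symmetric]
    using transpose_mult[OF N2 G] by (metis transpose_transpose)
  have Qc: "Q \<in> carrier_mat r2 r1" unfolding Q_def using N2 M N1T by auto
  have PT: "P\<^sup>T = G\<^sup>T @\<^sub>r K2"
    unfolding P_def append_rows_def
    by (subst transpose_four_block_mat[OF G K2T]) (use G K2 in auto)
  have GT: "G\<^sup>T \<in> carrier_mat r1 (dim_col K2)" using G by (simp add: n2_def)
  have "unimodular_equivalent P\<^sup>T (four_block_mat (1\<^sub>m m2) (0\<^sub>m m2 r2) (0\<^sub>m r1 m2) (G\<^sup>T * N2\<^sup>T))"
    using complementary_stack_equivalent[OF comp2 GT] unfolding PT defs .
  from unimodular_equivalent_transpose[OF this]
  have "unimodular_equivalent P (four_block_mat (1\<^sub>m m2) (0\<^sub>m m2 r2) (0\<^sub>m r1 m2) (G\<^sup>T * N2\<^sup>T))\<^sup>T" by simp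
  also have "(four_block_mat (1\<^sub>m m2) (0\<^sub>m m2 r2) (0\<^sub>m r1 m2) (G\<^sup>T * N2\<^sup>T))\<^sup>T =
      four_block_mat (1\<^sub>m m2) (0\<^sub>m m2 r1) (0\<^sub>m r2 m2) Q"
    unfolding Q[symmetric]
    by (subst transpose_four_block_mat[of _ m2 m2 _ r2 _ r1]) (use G N2 in auto)
  finally have "unimodular_equivalent P (four_block_mat (1\<^sub>m m2) (0\<^sub>m m2 r1) (0\<^sub>m r2 m2) Q)" .
  \<comment> \<open>The identity block from the first reduction is carried along while
    \<open>P\<close> is reduced; the nested identities then merge into one.\<close>
  from unimodular_equivalent_diag_one[OF this, of m1, unfolded carrier_matD[OF P]]
  have "unimodular_equivalent (A @\<^sub>r K) (four_block_mat (1\<^sub>m m1) (0\<^sub>m m1 (r1 + m2)) (0\<^sub>m n2 m1)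
      (four_block_mat (1\<^sub>m m2) (0\<^sub>m m2 r1) (0\<^sub>m r2 m2) Q))"
    using unimodular_equivalent_trans[OF step1] by blast
  also have "four_block_mat (1\<^sub>m m1) (0\<^sub>m m1 (r1 + m2)) (0\<^sub>m n2 m1)
      (four_block_mat (1\<^sub>m m2) (0\<^sub>m m2 r1) (0\<^sub>m r2 m2) Q) =
    four_block_mat (1\<^sub>m (m1 + m2)) (0\<^sub>m (m1 + m2) r1) (0\<^sub>m r2 (m1 + m2)) Q"
    by (rule eq_matI) (use Qc comp2 in \<open>auto simp: complementary_def defs\<close>)
  finally show ?thesis unfolding L Q_def defs .
qed

section \<open>Factoring through a complementary pair\<close>

text \<open>The field case is pulled back along the injective map into the fraction field.\<close>

lemma mat_mult_left_right_inverse_idom: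
  fixes A B :: "'b::idom mat"
  assumes A: "A \<in> carrier_mat n n" and B: "B \<in> carrier_mat n n" and AB: "A * B = 1\<^sub>m n"
  shows "B * A = 1\<^sub>m n"
proof -
  interpret inj_idom_hom "to_fract :: 'b \<Rightarrow> 'b fract" by unfold_locales auto
  have "map_mat to_fract A * map_mat to_fract B = 1\<^sub>m n"
    using mat_hom_mult[OF A B] AB by (simp add: mat_hom_one)
  then have "map_mat to_fract B * map_mat to_fract A = 1\<^sub>m n"
    by (rule mat_mult_left_right_inverse[rotated 2]) (use A B in auto)
  then have "map_mat to_fract (B * A) = map_mat to_fract (1\<^sub>m n)"
    using mat_hom_mult[OF B A] by (simp add: mat_hom_one)
  then show ?thesis by (rule mat_hom_inj)
qed

text \<open>Reversing the order of the inverse pair gives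
  \<open>B * K + N\<^sup>T * D = 1\<^sub>m n\<close>. Applied to \<open>R\<^sup>T\<close>, the first
  summand vanishes and the second exhibits \<open>R\<^sup>T\<close> as a multiple of
  \<open>N\<^sup>T\<close>.\<close>

lemma complementary_factor:
  fixes K N R :: "'a::field poly mat"
  assumes comp: "complementary K N" and R: "R \<in> carrier_mat r (dim_col K)"
    and KR: "K * R\<^sup>T = 0\<^sub>m (dim_row K) r"
  obtains T where "T \<in> carrier_mat r (dim_row N)" "R = T * N"
proof -
  define m n s where "m = dim_row K" and "n = dim_col K" and "s = dim_row N"
  have K: "K \<in> carrier_mat m n" and N: "N \<in> carrier_mat s n" and NT: "N\<^sup>T \<in> carrier_mat n s"
    and n: "m + s = n" and KN: "K * N\<^sup>T = 0\<^sub>m m s" and R: "R \<in> carrier_mat r n"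
    and RT: "R\<^sup>T \<in> carrier_mat n r" and KR: "K * R\<^sup>T = 0\<^sub>m m r"
    using comp R KR by (auto simp: complementary_def m_def n_def s_def)
  obtain B D where B: "B \<in> carrier_mat n m" and D: "D \<in> carrier_mat s n" and KB: "K * B = 1\<^sub>m m"
    and DB: "D * B = 0\<^sub>m s m" and DN: "D * N\<^sup>T = 1\<^sub>m s"
    using comp by (auto simp: complementary_def m_def n_def s_def)
  define V where "V = four_block_mat B N\<^sup>T (0\<^sub>m 0 m) (0\<^sub>m 0 s)"
  define W where "W = four_block_mat K (0\<^sub>m m 0) D (0\<^sub>m s 0)"
  have Vc: "V \<in> carrier_mat n n" and Wc: "W \<in> carrier_mat n n"
    unfolding V_def W_def using B NT K D n by auto
  have "W * V = four_block_mat (1\<^sub>m m) (0\<^sub>m m s) (0\<^sub>m s m) (1\<^sub>m s)"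
    unfolding W_def V_def
    by (subst mult_four_block_mat[OF K _ D _ B NT]) (use K N D B KB KN DB DN in auto)
  then have "W * V = 1\<^sub>m n" unfolding n[symmetric] by simp
  then have VW: "V * W = 1\<^sub>m n" by (rule mat_mult_left_right_inverse_idom[OF Wc Vc])
  have BK: "B * K \<in> carrier_mat n n" and ND: "N\<^sup>T * D \<in> carrier_mat n n"
    using mult_carrier_mat[OF B K] mult_carrier_mat[OF NT D] .
  have "V * W = four_block_mat (B * K + N\<^sup>T * D) (0\<^sub>m n 0) (0\<^sub>m 0 n) (0\<^sub>m 0 0)"
    unfolding W_def V_def
    by (subst mult_four_block_mat[OF B NT _ _ K _ D]) (use K N D B in auto)
  also have "\<dots> = B * K + N\<^sup>T * D"
    by (rule eq_matI) (use B K NT D in auto)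
  finally have id: "B * K + N\<^sup>T * D = 1\<^sub>m n" using VW by simp
  have "R\<^sup>T = (B * K + N\<^sup>T * D) * R\<^sup>T" unfolding id using RT by simp
  also have "\<dots> = B * K * R\<^sup>T + N\<^sup>T * D * R\<^sup>T" by (rule add_mult_distrib_mat[OF BK ND RT])
  also have "B * K * R\<^sup>T = 0\<^sub>m n r" unfolding assoc_mult_mat[OF B K RT] KR using B by simp
  also have "N\<^sup>T * D * R\<^sup>T = N\<^sup>T * (D * R\<^sup>T)" by (rule assoc_mult_mat[OF NT D RT])
  finally have RT_eq: "R\<^sup>T = N\<^sup>T * (D * R\<^sup>T)"
    using mult_carrier_mat[OF NT mult_carrier_mat[OF D RT]] by simp
  have "R = (N\<^sup>T * (D * R\<^sup>T))\<^sup>T" using RT_eq by (metis transpose_transpose)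
  also have "\<dots> = (D * R\<^sup>T)\<^sup>T * N"
    using transpose_mult[OF NT mult_carrier_mat[OF D RT]] by simp
  finally have "R = (D * R\<^sup>T)\<^sup>T * N" .
  moreover have "(D * R\<^sup>T)\<^sup>T \<in> carrier_mat r s" using D RT by simp
  ultimately show thesis using that unfolding s_def by blast
qed

subsection \<open>Dual minimal bases\<close>

text \<open>Minimality enters through saturation, which supplies the two right inverses for
  \<open>complementaryI\<close>.\<close>

lemma dual_minimal_bases_complementary:
  fixes K N :: "'a::field poly mat"
  assumes "dual_minimal_bases K N"
  shows "complementary K N"
proof -
  define m n r where "m = dim_row K" and "n = dim_col K" and "r = dim_row N"
  have min: "minimal_basis K" "minimal_basis N"
    and K: "K \<in> carrier_mat m n" and N: "N \<in> carrier_mat r n" and n: "m + r = n"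
    and KN: "K * N\<^sup>T = 0\<^sub>m m r"
    using assms by (auto simp: dual_minimal_bases_def m_def n_def r_def)
  obtain B where "B \<in> carrier_mat n m" "K * B = 1\<^sub>m m"
    using saturated_right_inverse[OF K minimal_basis_saturated[OF min(1)]] .
  moreover obtain C where "C \<in> carrier_mat n r" "N * C = 1\<^sub>m r"
    using saturated_right_inverse[OF N minimal_basis_saturated[OF min(2)]] .
  ultimately show ?thesis using complementaryI[OF K N n KN] by blast
qed

lemma complementary_empty:
  fixes K :: "'a::field poly mat"
  assumes "K \<in> carrier_mat 0 n"
  shows "complementary K (1\<^sub>m n)"
proof (rule complementaryI[OF assms])
  show "K * (1\<^sub>m n)\<^sup>T = 0\<^sub>m 0 n" "K * 0\<^sub>m n 0 = 1\<^sub>m 0" by (rule eq_matI; use assms in simp)+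
  show "1\<^sub>m n * 1\<^sub>m n = (1\<^sub>m n :: 'a poly mat)" by simp
qed auto

lemma dual_minimal_bases_or_empty_complementary:
  assumes "dual_minimal_bases_or_empty K N"
  shows "complementary K N"
  using assms unfolding dual_minimal_bases_or_empty_def
proof
  assume *: "dim_row K = 0 \<and> N = 1\<^sub>m (dim_col K)"
  then have "K \<in> carrier_mat 0 (dim_col K)" by (intro carrier_matI) simp_all
  then have "complementary K (1\<^sub>m (dim_col K))" by (rule complementary_empty)
  then show ?thesis unfolding conjunct2[OF *] .
qed (rule dual_minimal_bases_complementary)

section \<open>Grades and the row degrees of dual bases\<close>

text \<open>The entry degrees bound the indices of nonzero coefficient matrices, so the set under
  \<open>Max\<close> is finite and the grade can be read off entrywise.\<close>

lemma has_grade_iff: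
  fixes P :: "'a::field poly mat"
  shows "has_grade d P \<longleftrightarrow> (\<forall>i<dim_row P. \<forall>j<dim_col P. degree (P $$ (i, j)) \<le> d)"
proof -
  let ?S = "{k. coeff_matrix P k \<noteq> 0\<^sub>m (dim_row P) (dim_col P)}"
  have S: "k \<in> ?S \<longleftrightarrow> (\<exists>i<dim_row P. \<exists>j<dim_col P. coeff (P $$ (i, j)) k \<noteq> 0)" for k
    by (auto simp: coeff_matrix_def mat_eq_iff)
  have "?S \<subseteq> (\<Union>i<dim_row P. \<Union>j<dim_col P. {..degree (P $$ (i, j))})"
    using S by (fastforce intro: le_degree)
  then have "finite ?S" by (rule finite_subset) auto
  then have "has_grade d P \<longleftrightarrow> (\<forall>k\<in>?S. k \<le> d)"
    unfolding has_grade_def mpoly_degree_def by (subst Max_le_iff) auto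
  also have "\<dots> \<longleftrightarrow> (\<forall>i<dim_row P. \<forall>j<dim_col P. degree (P $$ (i, j)) \<le> d)"
  proof
    assume *: "\<forall>k\<in>?S. k \<le> d"
    show "\<forall>i<dim_row P. \<forall>j<dim_col P. degree (P $$ (i, j)) \<le> d"
    proof (intro allI impI)
      fix i j assume "i < dim_row P" "j < dim_col P"
      then have "P $$ (i, j) \<noteq> 0 \<Longrightarrow> degree (P $$ (i, j)) \<in> ?S"
        unfolding S using leading_coeff_neq_0 by blast
      then show "degree (P $$ (i, j)) \<le> d" using * by (cases "P $$ (i, j) = 0") auto
    qed
  next
    assume *: "\<forall>i<dim_row P. \<forall>j<dim_col P. degree (P $$ (i, j)) \<le> d"
    show "\<forall>k\<in>?S. k \<le> d"
    proof
      fix k assume "k \<in> ?S"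
      then obtain i j where "i < dim_row P" "j < dim_col P" "coeff (P $$ (i, j)) k \<noteq> 0"
        unfolding S by blast
      then show "k \<le> d" using * le_degree order_trans by blast
    qed
  qed
  finally show ?thesis .
qed

lemma has_grade_mpoly_degree: "has_grade (mpoly_degree P) P"
  by (simp add: has_grade_def)

text \<open>
  The rows of \<open>R\<close> are combinations of the rows of \<open>N\<close>, so their degrees are at least \<open>d\<close> by the exchange
  property; minimality of \<open>R\<close> bounds their sum.
\<close>

lemma dual_minimal_bases_row_degrees:
  fixes K N R :: "'a::field poly mat"
  assumes KN: "dual_minimal_bases K N" and KR: "dual_minimal_bases K R"
    and d: "\<And>k. k < dim_row N \<Longrightarrow> row_degree N k = d" and i: "i < dim_row R"
  shows "row_degree R i = d"
proof -
  define r n where "r = dim_row N" and "n = dim_col K"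
  have N: "N \<in> carrier_mat r n" and R: "R \<in> carrier_mat r n"
    using KN KR by (auto simp: dual_minimal_bases_def r_def n_def)
  have minN: "minimal_basis N" and minR: "minimal_basis R"
    using KN KR by (auto simp: dual_minimal_bases_def)
  have zN: "K * N\<^sup>T = 0\<^sub>m (dim_row K) r" and zR: "K * R\<^sup>T = 0\<^sub>m (dim_row K) r"
    using KN KR N R by (auto simp: dual_minimal_bases_def)
  note cN = dual_minimal_bases_complementary[OF KN] and cR = dual_minimal_bases_complementary[OF KR]
  \<comment> \<open>Each dual basis is a polynomial multiple of the other; cancelling
    \<open>R\<close> by its right inverse \<open>C\<close> shows that the two factors are inverse to
    each other.\<close>
  obtain T where T: "T \<in> carrier_mat r r" "R = T * N"
    using complementary_factor[OF cN R[unfolded n_def] zR] N by auto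
  obtain T' where T': "T' \<in> carrier_mat r r" "N = T' * R"
    using complementary_factor[OF cR N[unfolded n_def] zN] R by auto
  obtain C where C: "C \<in> carrier_mat n r" "R * C = 1\<^sub>m r"
    using saturated_right_inverse[OF R minimal_basis_saturated[OF minR]] .
  have TT': "T * T' = 1\<^sub>m r"
  proof -
    have "R = T * T' * R" using T(2) T'(2) assoc_mult_mat[OF T(1) T'(1) R] by simp
    then have "R * C = T * T' * R * C" by simp
    also have "\<dots> = T * T' * (R * C)"
      by (rule assoc_mult_mat[OF mult_carrier_mat[OF T(1) T'(1)] R C(1)])
    finally show ?thesis unfolding C(2) right_mult_one_mat[OF mult_carrier_mat[OF T(1) T'(1)]] by simp
  qed
  interpret to_fract_hom: inj_idom_hom "to_fract :: 'a poly \<Rightarrow> 'a poly fract" by unfold_locales auto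
  have "is_polynomial_basis N (rational_row_space R)"
  proof (rule is_polynomial_basis_transform[OF R N, of "rational_mat T'" "rational_mat T"])
    show "rational_mat T' * rational_mat T = 1\<^sub>m r"
      using mat_mult_left_right_inverse_idom[OF T(1) T'(1) TT'] to_fract_hom.mat_hom_mult[OF T'(1) T(1)]
      by (simp add: to_fract_hom.mat_hom_one)
    show "rational_mat N = rational_mat T' * rational_mat R"
      using to_fract_hom.mat_hom_mult[OF T'(1) R] T'(2) by simp
    show "is_polynomial_basis R (rational_row_space R)" using minR by (simp add: minimal_basis_def)
  qed (use T T' in auto)
  then have "row_degree_sum R \<le> row_degree_sum N"
    using minR N R unfolding minimal_basis_def by auto
  then have le: "sum (row_degree R) {..<r} \<le> sum (\<lambda>_. d) {..<r}"
    using N R d by (simp add: row_degree_sum_def)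
  have ge: "d \<le> row_degree R l" if l: "l < r" for l
  proof -
    \<comment> \<open>A zero row of \<open>T\<close> would contradict its invertibility. A nonzero
      entry selects the row of \<open>N\<close> for the exchange, used with
      \<open>q = 1\<close>.\<close>
    have "\<exists>k<r. T $$ (l, k) \<noteq> 0"
    proof (rule ccontr)
      assume "\<not> ?thesis"
      then have "(T * T') $$ (l, l) = 0"
        using l T(1) T'(1) by (simp add: scalar_prod_def)
      then show False using l unfolding TT' by simp
    qed
    then obtain k where k: "k < dim_row N" "T $$ (l, k) \<noteq> 0" using N by auto
    have "(\<Sum>k<dim_row N. T $$ (l, k) * N $$ (k, j)) = 1 * R $$ (l, j)" if "j < dim_col N" for j
      using that l N T(1) unfolding T(2) by (simp add: scalar_prod_def atLeast0LessThan)
    from minimal_basis_exchange[OF minN _ k(1), of 1 "\<lambda>k. T $$ (l, k)", OF _ k(2) this]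
    obtain j where "j < dim_col N" "row_degree N k \<le> degree (R $$ (l, j))" by auto
    then show ?thesis using degree_le_row_degree[of j R l] d[OF k(1)] N R by simp
  qed
  show ?thesis
  proof (rule ccontr)
    assume ne: "row_degree R i \<noteq> d"
    have ir: "i < r" using i R by simp
    then have "d < row_degree R i" using ge[OF ir] ne by simp
    then have "sum (\<lambda>_. d) {..<r} < sum (row_degree R) {..<r}"
      using ge ir by (intro sum_strict_mono_ex1) auto
    then show False using le by simp
  qed
qed

lemma mpoly_degree_eq_row_degree:
  fixes N :: "'a::field poly mat"
  assumes "0 < dim_row N" "0 < dim_col N" and d: "\<And>i. i < dim_row N \<Longrightarrow> row_degree N i = d"
  shows "mpoly_degree N = d"
proof (rule antisym)
  have "has_grade d N" unfolding has_grade_iff using d degree_le_row_degree[of _ N] by metis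
  then show "mpoly_degree N \<le> d" by (simp add: has_grade_def)
  have "\<forall>j<dim_col N. degree (N $$ (0, j)) \<le> mpoly_degree N"
    using has_grade_mpoly_degree[of N] assms(1) unfolding has_grade_iff by simp
  then have "row_degree N 0 < Suc (mpoly_degree N)"
    using row_degree_less_iff[OF assms(2), of 0] by auto
  then show "d \<le> mpoly_degree N" using d[OF assms(1)] by simp
qed

section \<open>Reversal of matrices and of dual bases\<close>

lemma transpose_mpoly_rev: "(mpoly_rev d P)\<^sup>T = mpoly_rev d P\<^sup>T"
  by (rule eq_matI) (auto simp: mpoly_rev_def)

lemma mpoly_rev_mult:
  fixes A B :: "'a::field poly mat"
  assumes A: "A \<in> carrier_mat m n" "has_grade d A" and B: "B \<in> carrier_mat n r" "has_grade e B"
  shows "mpoly_rev (d + e) (A * B) = mpoly_rev d A * mpoly_rev e B"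
proof (rule eq_matI)
  fix i j assume "i < dim_row (mpoly_rev d A * mpoly_rev e B)" "j < dim_col (mpoly_rev d A * mpoly_rev e B)"
  then have ij: "i < m" "j < r" using A B by (auto simp: mpoly_rev_def)
  have "degree (A $$ (i, k)) \<le> d" "degree (B $$ (k, j)) \<le> e" if "k < n" for k
    using A B ij that unfolding has_grade_iff by auto
  then have "(\<Sum>k<n. rev_poly (d + e) (A $$ (i, k) * B $$ (k, j))) =
    (\<Sum>k<n. rev_poly d (A $$ (i, k)) * rev_poly e (B $$ (k, j)))"
    by (intro sum.cong) (auto simp: rev_poly_mult)
  then show "mpoly_rev (d + e) (A * B) $$ (i, j) = (mpoly_rev d A * mpoly_rev e B) $$ (i, j)"
    using ij A B by (simp add: mpoly_rev_def scalar_prod_def atLeast0LessThan rev_poly_sum)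
qed (use A B in \<open>auto simp: mpoly_rev_def\<close>)

lemma has_grade_mult:
  fixes A B :: "'a::field poly mat"
  assumes A: "A \<in> carrier_mat m n" "has_grade d A" and B: "B \<in> carrier_mat n r" "has_grade e B"
  shows "has_grade (d + e) (A * B)"
  unfolding has_grade_iff
proof (intro allI impI)
  fix i j assume "i < dim_row (A * B)" "j < dim_col (A * B)"
  then have ij: "i < m" "j < r" using A B by auto
  have deg: "degree (A $$ (i, k)) \<le> d" "degree (B $$ (k, j)) \<le> e" if "k < n" for k
    using A B ij that unfolding has_grade_iff by auto
  have "degree (\<Sum>k<n. A $$ (i, k) * B $$ (k, j)) \<le> d + e"
    using deg by (intro degree_sum_le) (auto intro!: order_trans[OF degree_mult_le] add_mono)
  then show "degree ((A * B) $$ (i, j)) \<le> d + e"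
    using ij A B by (simp add: scalar_prod_def atLeast0LessThan)
qed

lemma has_grade_transpose: "has_grade d P\<^sup>T \<longleftrightarrow> has_grade d P"
  unfolding has_grade_iff by auto

text \<open>The equal row degrees are known for some dual basis \<open>R\<close>, and
  \<open>dual_minimal_bases_row_degrees\<close> transfers them to the given \<open>N\<close>. Then
  both reversals are saturated, and reversing \<open>K * N\<^sup>T = 0\<close> keeps them
  orthogonal.\<close>

lemma dual_minimal_bases_or_empty_rev_complementary:
  fixes K N R :: "'a::field poly mat"
  assumes dual: "dual_minimal_bases_or_empty K N"
    and degK: "\<forall>i<dim_row K. row_degree K i = e"
    and dual': "dual_minimal_bases_or_empty K R"
    and degR: "\<forall>i<dim_row R. \<forall>j<dim_row R. row_degree R i = row_degree R j"
  shows "complementary (mpoly_rev e K) (mpoly_rev (mpoly_degree N) N)"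
proof (cases "dim_row K = 0")
  case True
  \<comment> \<open>With no rows in \<open>K\<close> the matrix \<open>N\<close> would have to be
    square, which \<open>minimal_basis\<close> excludes.\<close>
  then have "\<not> dual_minimal_bases K N" by (auto simp: dual_minimal_bases_def minimal_basis_def)
  then have N: "N = 1\<^sub>m (dim_col K)" using dual by (auto simp: dual_minimal_bases_or_empty_def)
  have "has_grade 0 N" unfolding N has_grade_iff by simp
  then have "mpoly_degree N = 0" by (simp add: has_grade_def)
  moreover have "mpoly_rev 0 N = 1\<^sub>m (dim_col K)"
    unfolding N by (rule eq_matI) (auto simp: mpoly_rev_def rev_poly_def monom_0)
  moreover have "mpoly_rev e K \<in> carrier_mat 0 (dim_col K)" using True by (intro carrier_matI) (simp_all add: mpoly_rev_def)
  ultimately show ?thesis using complementary_empty[of "mpoly_rev e K" "dim_col K"] by simp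
next
  case False
  then have KN: "dual_minimal_bases K N" and KR: "dual_minimal_bases K R"
    using dual dual' by (auto simp: dual_minimal_bases_or_empty_def)
  define m n r where "m = dim_row K" and "n = dim_col K" and "r = dim_row N"
  have min: "minimal_basis K" "minimal_basis N"
    and K: "K \<in> carrier_mat m n" and N: "N \<in> carrier_mat r n" and n: "m + r = n"
    and zero: "K * N\<^sup>T = 0\<^sub>m m r"
    using KN by (auto simp: dual_minimal_bases_def m_def n_def r_def)
  have r0: "0 < r" and n0: "0 < n" using min(1) K n by (auto simp: minimal_basis_def)
  have "dim_row R = r" using KR K N n by (auto simp: dual_minimal_bases_def)
  then have "row_degree R k = row_degree R 0" if "k < dim_row R" for k
    using degR that r0 by blast
  then have "row_degree N i = row_degree R 0" if "i < dim_row N" for i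
    using dual_minimal_bases_row_degrees[OF KR KN _ that] by blast
  moreover from this have "mpoly_degree N = row_degree R 0"
    using mpoly_degree_eq_row_degree[of N] r0 n0 N by simp
  ultimately have degN: "row_degree N i = mpoly_degree N" if "i < dim_row N" for i
    using that by simp
  define d where "d = mpoly_degree N"
  have rK: "mpoly_rev e K \<in> carrier_mat m n" and rN: "mpoly_rev d N \<in> carrier_mat r n"
    using K N by (auto simp: mpoly_rev_def)
  have gK: "has_grade e K" unfolding has_grade_iff using degK degree_le_row_degree[of _ K] by metis
  have "mpoly_rev e K * (mpoly_rev d N)\<^sup>T = mpoly_rev (e + d) (K * N\<^sup>T)"
    unfolding transpose_mpoly_rev
    by (rule mpoly_rev_mult[symmetric, of _ m n _ _ r])
      (use K N gK has_grade_mpoly_degree[of N] in \<open>auto simp: has_grade_transpose d_def\<close>)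
  also have "\<dots> = 0\<^sub>m m r" unfolding zero by (rule eq_matI) (auto simp: mpoly_rev_def)
  finally have "mpoly_rev e K * (mpoly_rev d N)\<^sup>T = 0\<^sub>m m r" .
  moreover obtain B where "B \<in> carrier_mat n m" "mpoly_rev e K * B = 1\<^sub>m m"
    using saturated_right_inverse[OF rK minimal_basis_rev_saturated[OF min(1)]] degK by blast
  moreover obtain C where "C \<in> carrier_mat n r" "mpoly_rev d N * C = 1\<^sub>m r"
    using saturated_right_inverse[OF rN minimal_basis_rev_saturated[OF min(2)]] degN
    unfolding d_def by blast
  ultimately show ?thesis using complementaryI[OF rK rN n] unfolding d_def by blast
qed

section \<open>Linearization and strong linearization\<close>

lemma block_pencil_linearization:
  fixes K1 N1 K2 N2 M :: "'a::field poly mat"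
  assumes "complementary K1 N1" "complementary K2 N2" "M \<in> carrier_mat (dim_col K2) (dim_col K1)"
    and "is_pencil (block_pencil M K1 K2)"
  shows "linearization (block_pencil M K1 K2) (N2 * M * N1\<^sup>T)"
proof -
  have "dim_row (N2 * M * N1\<^sup>T) = dim_row N2" "dim_col (N2 * M * N1\<^sup>T) = dim_row N1" by simp_all
  then show ?thesis
    using block_pencil_equivalent[OF assms(1-3)] assms(4)
    unfolding linearization_def unimodular_equivalent_def by metis
qed

lemma mpoly_rev_block_pencil:
  fixes M :: "'a::field poly mat"
  assumes "M \<in> carrier_mat (dim_col K2) (dim_col K1)"
  shows "mpoly_rev d (block_pencil M K1 K2) =
    block_pencil (mpoly_rev d M) (mpoly_rev d K1) (mpoly_rev d K2)"
  by (rule eq_matI) (use assms in \<open>auto simp: mpoly_rev_def block_pencil_def\<close>)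

theorem theorem3p3:
  fixes K1 N1 K2 N2 M L Q :: "'a::field poly mat"
  assumes "dual_minimal_bases_or_empty K1 N1"
    and "dual_minimal_bases_or_empty K2 N2"
    and "M \<in> carrier_mat (dim_col K2) (dim_col K1)"
    and "L = block_pencil M K1 K2"
    and "is_pencil L"
    and "Q = N2 * M * transpose_mat N1"
  shows "linearization L Q \<and>
    (strong_block_minimal_bases_pencil M K1 K2 \<longrightarrow>
      strong_linearization (1 + mpoly_degree N1 + mpoly_degree N2) L Q)"
proof (intro conjI impI)
  note comp = dual_minimal_bases_or_empty_complementary[OF assms(1)]
    dual_minimal_bases_or_empty_complementary[OF assms(2)]
  show lin: "linearization L Q"
    using block_pencil_linearization[OF comp assms(3)] assms(4-6) by simp
  assume strong: "strong_block_minimal_bases_pencil M K1 K2"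
  define d1 d2 where "d1 = mpoly_degree N1" and "d2 = mpoly_degree N2"
  have dims: "dim_col N1 = dim_col K1" "dim_col N2 = dim_col K2"
    using comp by (auto simp: complementary_def)
  have N1T: "N1\<^sup>T \<in> carrier_mat (dim_col K1) (dim_row N1)"
    and N2: "N2 \<in> carrier_mat (dim_row N2) (dim_col K2)"
    using dims by (auto intro: carrier_matI)
  have gM: "has_grade 1 M"
    unfolding has_grade_iff
  proof (intro allI impI)
    fix i j assume ij: "i < dim_row M" "j < dim_col M"
    then have "L $$ (i, j) = M $$ (i, j)" "i < dim_row L" "j < dim_col L"
      using assms(3) unfolding assms(4) block_pencil_def by auto
    then show "degree (M $$ (i, j)) \<le> 1"
      using assms(5) unfolding has_grade_iff by metis
  qed
  have gN1: "has_grade d1 N1\<^sup>T" and gN2: "has_grade d2 N2"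
    by (simp_all add: d1_def d2_def has_grade_transpose has_grade_mpoly_degree)
  have gN2M: "has_grade (d2 + 1) (N2 * M)" by (rule has_grade_mult[OF N2 gN2 assms(3) gM])
  have N2M: "N2 * M \<in> carrier_mat (dim_row N2) (dim_col K1)" using mult_carrier_mat[OF N2 assms(3)] .
  \<comment> \<open>The summands of the grade follow the bracketing of the product \<open>Q\<close>;
    they are reordered at the end.\<close>
  have gQ: "has_grade (d2 + 1 + d1) Q"
    unfolding assms(6) by (rule has_grade_mult[OF N2M gN2M N1T gN1])
  \<comment> \<open>Because the grades of the factors add up, the reversed \<open>Q\<close> is the
    same triple product formed from the reversed factors. The reversed pencil has the reversed
    blocks, so the argument for \<open>L\<close> applies to it.\<close>
  have revQ: "mpoly_rev (d2 + 1 + d1) Q = mpoly_rev d2 N2 * mpoly_rev 1 M * (mpoly_rev d1 N1)\<^sup>T"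
    unfolding assms(6) mpoly_rev_mult[OF N2M gN2M N1T gN1] mpoly_rev_mult[OF N2 gN2 assms(3) gM]
      transpose_mpoly_rev ..
  have "complementary (mpoly_rev 1 K1) (mpoly_rev d1 N1)" "complementary (mpoly_rev 1 K2) (mpoly_rev d2 N2)"
    using strong dual_minimal_bases_or_empty_rev_complementary[OF assms(1)]
      dual_minimal_bases_or_empty_rev_complementary[OF assms(2)]
    unfolding strong_block_minimal_bases_pencil_def d1_def d2_def by blast+
  moreover have "is_pencil (mpoly_rev 1 L)"
    unfolding has_grade_iff by (simp add: mpoly_rev_def degree_rev_poly_le)
  ultimately have "linearization (mpoly_rev 1 L) (mpoly_rev (d2 + 1 + d1) Q)"
    unfolding assms(4) mpoly_rev_block_pencil[OF assms(3)] revQ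
    by (intro block_pencil_linearization) (use assms(3) in \<open>auto simp: mpoly_rev_def\<close>)
  then show "strong_linearization (1 + mpoly_degree N1 + mpoly_degree N2) L Q"
    unfolding strong_linearization_def d1_def[symmetric] d2_def[symmetric]
    using lin gQ by (simp add: ac_simps)
qed

end
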